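(* Consider the uncertain closed-loop system $x(t+1)=A_d x(t)+B_d\pi(x(t))$ with $A_d\in[\underline A_d,\overline A_d]\subset\mathbb R^{n\times n}$, $B_d\in[\underline B_d,\overline B_d]\subset\mathbb R^{n\times m}$, where $\pi$ is the given $\ell$-layer feedforward network with $\pi(0)=0$. Let $x_*=0$, $u_*=0$, and let $v_*,w_*\in\mathbb R^{n_\phi}$ be the corresponding equilibrium activation inputs and outputs. Let $\overline v^1\in\mathbb R^{n_1}$ with $\overline v^1\ge v_*^1$, put $\underline v^1:=2v_*^1-\overline v^1$, and let $\underline v\le v_*\le\overline v$ in $\mathbb R^{n_\phi}$ be vectors whose first-layer blocks are $\underline v^1,\overline v^1$ and such that for every $x\in\mathbb R^n$ with $\underline v^1\le W^1x+b^1\le\overline v^1$ the network's concatenated activation input $v_\phi$ at $x$ satisfies $\underline v\le v_\phi\le\overline v$. Let $\alpha_\phi\le\beta_\phi$ in $\mathbb R^{n_\phi}$ be such that $\phi$ is locally sector-bounded in the sector $[\alpha_\phi,\beta_\phi]$ around $(v_*,w_* )$ entrywise for all $v_\phi\in[\underline v,\overline v]$. If any one of the three systems of linear matrix inequalities (LMI-I), (LMI-II), (LMI-III) (defined in the context) is feasible, with $P$ the positive definite matrix of a feasible solution, then: (i) the uncertain closed-loop system is locally stable around $x_*=0$; and (ii) the set $\mathcal E(P,x_* )=\{x\in\mathbb R^n:(x-x_* )^\top P(x-x_* )\le1\}$ is contained in the robust region of attraction $$\tilde{\mathcal R}=\Big\{x\in\mathbb R^n:\ \lim_{t\to\infty}\mathscr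 X(t,x,A_d,B_d)=x_*\ \ \forall A_d\in[\underline A_d,\overline A_d],\ \forall B_d\in[\underline B_d,\overline B_d]\Big\}.$$
   Context: Inequalities $\le,\ge$ between vectors or matrices are entrywise; $\prec,\preceq,\succ,\succeq$ refer to definiteness of symmetric matrices; $*$ denotes a block determined by symmetry. For $\underline A\le\overline A$, $[\underline A,\overline A]$ is the set of matrices $A$ with $\underline A(i,j)\le A(i,j)\le\overline A(i,j)$ for all $i,j$. Network: $\pi:\mathbb R^n\to\mathbb R^m$ is given by $w^0=x$, $v^i=W^iw^{i-1}+b^i$, $w^i=\phi^i(v^i)$ for $i=1,\dots,\ell$, $\pi(x)=W^{\ell+1}w^\ell+b^{\ell+1}$, with $n_0=n$, $W^i\in\mathbb R^{n_i\times n_{i-1}}$, $b^i\in\mathbb R^{n_i}$ for $i\le\ell$, $W^{\ell+1}\in\mathbb R^{m\times n_\ell}$, $b^{\ell+1}\in\mathbb R^m$, and $\phi^i$ applying a scalar activation function $\varphi:\mathbb R\to\mathbb R$ entrywise. It is assumed that $\pi(0)=0$. Let $n_\phi=\sum_{i=1}^\ell n_i$, let $v_\phi,w_\phi\in\mathbb R^{n_\phi}$ be the stacked vectors $(v^1,\dots,v^\ell)$, $(w^1,\dots,w^\ell)$, and let $\phi:\mathbb R^{n_\phi}\to\mathbb R^{n_\phi}$ apply $\varphi$ entrywise, so $w_\phi=\phi(v_\phi)$. The vectors $v_*=(v_*^1,\dots,v_*^\ell)$ and $w_*=\phi(v_* )$ are the values of $v_\phi,w_\phi$ at input $x=0$;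 $v_{*,i}^1$ and $\overline v_i^1$ are the $i$-th entries of $v_*^1$ and $\overline v^1$. The matrices $N_{vx},N_{vw},N_{ux},N_{uw}$ are defined by writing $v_\phi=N_{vx}x+N_{vw}w_\phi+N_{vb}$ and $u=\pi(x)=N_{ux}x+N_{uw}w_\phi+N_{ub}$: $N_{vx}\in\mathbb R^{n_\phi\times n}$ has first block row $W^1$ and all other block rows zero; $N_{vw}\in\mathbb R^{n_\phi\times n_\phi}$ has block $W^{i}$ in block position $(i,i-1)$ for $i=2,\dots,\ell$ and zeros elsewhere; $N_{ux}=0_{m\times n}$; $N_{uw}=[0\ \cdots\ 0\ W^{\ell+1}]\in\mathbb R^{m\times n_\phi}$. Local sector bound: a scalar function $\varphi$ is locally sector-bounded in $[\alpha,\beta]$ around $(v_*,\varphi(v_* ))$ on $[\underline v,\overline v]\ni v_*$ if $(\Delta\varphi(v)-\alpha\Delta v)(\Delta\varphi(v)-\beta\Delta v)\le0$ for all $v\in[\underline v,\overline v]$, where $\Delta\varphi(v)=\varphi(v)-\varphi(v_* )$, $\Delta v=v-v_*$. For $\phi$ this is required in each coordinate with the corresponding entries of $\alpha_\phi,\beta_\phi,\underline v,\overline v,v_*$. Matrices: $$R_V=\begin{bmatrix}I_n&0_{n\times n_\phi}\\N_{ux}&N_{uw}\end{bmatrix},\quad R_\phi=\begin{bmatrix}N_{vx}&N_{vw}\\0_{n_\phi\times n}&I_{n_\phi}\end{bmatrix},\quad \Psi_\phi=\begin{bmatrix}\operatorname{diag}(\beta_\phi)&-I_{n_\phi}\\-\operatorname{diag}(\alpha_\phi)&I_{n_\phi}\end{bmatrix},$$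 $$M_\phi(\lambda)=\begin{bmatrix}0&\operatorname{diag}(\lambda)\\\operatorname{diag}(\lambda)&0\end{bmatrix},\quad X(\lambda)=R_\phi^\top\Psi_\phi^\top M_\phi(\lambda)\Psi_\phi R_\phi.$$ Let $A_0=\frac12(\overline A_d+\underline A_d)$, $A_r=\frac12(\overline A_d-\underline A_d)$. Let $\underline B_N,\overline B_N\in\mathbb R^{n\times n_\phi}$ be the entrywise infimum and supremum of $B_dN_{uw}$ over $B_d\in[\underline B_d,\overline B_d]$, and $\tilde B_0=\frac12(\overline B_N+\underline B_N)$, $\tilde B_r=\frac12(\overline B_N-\underline B_N)$. Put $\hat n=2n+n_\phi$, $D=[A_r\ \ \tilde B_r\ \ 0_{n\times n}]^\top\in\mathbb R^{\hat n\times n}$, let $e_i\in\mathbb R^{\hat n}$ be the $i$-th standard basis vector, and $$Z(\lambda,P)=\begin{bmatrix}-R_V^\top\begin{bmatrix}I_n\\0_{m\times n}\end{bmatrix}P\begin{bmatrix}I_n&0_{n\times m}\end{bmatrix}R_V+X(\lambda)&*\\P\begin{bmatrix}A_0&\tilde B_0\end{bmatrix}&-P\end{bmatrix}\in\mathbb R^{\hat n\times\hat n}.$$ For scalars $\gamma_{ij}$ ($1\le i\le\hat n$, $1\le j\le n$), put $V=\operatorname{diag}(\gamma_{11},\dots,\gamma_{1n},\dots,\gamma_{\hat n1},\dots,\gamma_{\hat nn})$ and $$U=\begin{bmatrix}0_{(n+n_\phi)\times n}&\cdots&0_{(n+n_\phi)\times n}\\P&\cdots&P\end{bmatrix}\in\mathbb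 R^{\hat n\times\hat nn}\quad(\hat n\text{ block columns}).$$ Condition (N) on $P$: $\begin{bmatrix}(\overline v_i^1-v_{*,i}^1)^2&W_i^1\\(W_i^1)^\top&P\end{bmatrix}\succeq0$ for all $i\in\{1,\dots,n_1\}$, where $W_i^1$ is the $i$-th row of $W^1$. (LMI-I) is feasible if there exist a symmetric positive definite $P\in\mathbb R^{n\times n}$, $\lambda\in\mathbb R^{n_\phi}_{\ge0}$ and scalars $\gamma_{ij}>0$ such that (N) holds and $$\begin{bmatrix}Z(\lambda,P)+\sum_{i=1}^{\hat n}\sum_{j=1}^n\gamma_{ij}(D(i,j))^2e_ie_i^\top&U\\ *&-V\end{bmatrix}\prec0.$$ (LMI-II) is feasible if there exist a symmetric positive definite $P\in\mathbb R^{n\times n}$, $\lambda\in\mathbb R^{n_\phi}_{\ge0}$ and diagonal matrices $T\in\mathbb R^{\hat n\times\hat n}$, $S\in\mathbb R^{n\times n}$ such that (N) holds, $DSD^\top\prec T$, and $$\begin{bmatrix}Z(\lambda,P)+T&*\\ \begin{bmatrix}0_{n\times(n+n_\phi)}&P\end{bmatrix}&-S\end{bmatrix}\prec0.$$ (LMI-III) is feasible if there exist a symmetric positive definite $P\in\mathbb R^{n\times n}$, $\lambda\in\mathbb R^{n_\phi}_{\ge0}$, scalars $\gamma_{ij}>0$ and a symmetric $Y\in\mathbb R^{\hat n\times\hat n}$ such that (N) holds, $Y\prec-Z(\lambda,P)$, and $$\begin{bmatrix}Y-\sum_{i=1}^{\hat n}\sum_{j=1}^n\gamma_{ij}(D(i,j))^2e_ie_i^\top&U\\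 *&V\end{bmatrix}\succ0.$$ $\mathscr X(t,x_0,A_d,B_d)$ denotes the solution at time $t$ of $x(t+1)=A_dx(t)+B_d\pi(x(t))$, $x(0)=x_0$, with (time-invariant) $A_d,B_d$. The uncertain system is locally stable around $x_*$ if, for every $A_d\in[\underline A_d,\overline A_d]$ and $B_d\in[\underline B_d,\overline B_d]$, the equilibrium $x_*$ of this system is stable in the sense of Lyapunov. *)

theory Defs
  imports Complex_Main "Jordan_Normal_Form.Matrix"
begin

text \<open>Matrices and vectors are those of \<^theory>\<open>Jordan_Normal_Form.Matrix\<close>, whose order
  \<open>\<le>\<close> is entrywise (and forces equal dimensions); hence \<open>{A..B}\<close> is the interval matrix
  \<open>[A, B]\<close>. Entries are indexed from 0, whereas layers and blocks are numbered from 1.\<close>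

definition symmetric_mat :: "real mat \<Rightarrow> bool" where
  "symmetric_mat A \<longleftrightarrow> square_mat A \<and> transpose_mat A = A"

definition pos_def :: "real mat \<Rightarrow> bool" where
  "pos_def A \<longleftrightarrow> symmetric_mat A \<and>
     (\<forall>x\<in>carrier_vec (dim_row A). x \<noteq> 0\<^sub>v (dim_row A) \<longrightarrow> x \<bullet> (A *\<^sub>v x) > 0)"

definition pos_semidef :: "real mat \<Rightarrow> bool" where
  "pos_semidef A \<longleftrightarrow> symmetric_mat A \<and>
     (\<forall>x\<in>carrier_vec (dim_row A). x \<bullet> (A *\<^sub>v x) \<ge> 0)"

definition mat_prec :: "real mat \<Rightarrow> real mat \<Rightarrow> bool" (infix \<open>\<prec>\<close> 50) where
  "A \<prec> B \<longleftrightarrow> symmetric_mat A \<and> symmetric_mat B \<and> dim_row A = dim_row B \<and> pos_def (B - A)"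

definition vnorm :: "real vec \<Rightarrow> real" where
  "vnorm x = sqrt (x \<bullet> x)"

definition diag_of_vec :: "real vec \<Rightarrow> real mat" where
  "diag_of_vec d = mat_diag (dim_vec d) (\<lambda>i. d $ i)"

definition append_cols :: "real mat \<Rightarrow> real mat \<Rightarrow> real mat" (infixr \<open>@\<^sub>c\<close> 65) where
  "A @\<^sub>c B = four_block_mat A B (0\<^sub>m 0 (dim_col A)) (0\<^sub>m 0 (dim_col B))"

text \<open>\<open>hcat r B k = [B 1 \<dots> B k]\<close> for blocks with \<open>r\<close> rows; \<open>vcat c B k\<close> stacks
  \<open>B 1, \<dots>, B k\<close>, all with \<open>c\<close> columns; \<open>stack v k = (v 1, \<dots>, v k)\<close>.\<close>

primrec hcat :: "nat \<Rightarrow> (nat \<Rightarrow> real mat) \<Rightarrow> nat \<Rightarrow> real mat" where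
  "hcat r B 0 = 0\<^sub>m r 0"
| "hcat r B (Suc k) = hcat r B k @\<^sub>c B (Suc k)"

primrec vcat :: "nat \<Rightarrow> (nat \<Rightarrow> real mat) \<Rightarrow> nat \<Rightarrow> real mat" where
  "vcat c B 0 = 0\<^sub>m 0 c"
| "vcat c B (Suc k) = vcat c B k @\<^sub>r B (Suc k)"

primrec stack :: "(nat \<Rightarrow> real vec) \<Rightarrow> nat \<Rightarrow> real vec" where
  "stack v 0 = vNil"
| "stack v (Suc k) = stack v k @\<^sub>v v (Suc k)"

text \<open>\<open>width N i\<close> is \<open>n\<^sub>i\<close> for \<open>1 \<le> i \<le> \<ell>\<close>, the input dimension \<open>n\<close> for \<open>i = 0\<close> and the
  output dimension \<open>m\<close> for \<open>i = \<ell> + 1\<close>, where \<open>\<ell> = depth N\<close>.\<close>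

record network =
  depth :: nat
  width :: "nat \<Rightarrow> nat"
  weight :: "nat \<Rightarrow> real mat"
  bias :: "nat \<Rightarrow> real vec"
  activation :: "real \<Rightarrow> real"

definition wf_network :: "network \<Rightarrow> bool" where
  "wf_network N \<longleftrightarrow> depth N \<ge> 1 \<and>
     (\<forall>i\<in>{1..depth N + 1}.
        weight N i \<in> carrier_mat (width N i) (width N (i - 1)) \<and>
        bias N i \<in> carrier_vec (width N i))"

definition in_dim :: "network \<Rightarrow> nat" where
  "in_dim N = width N 0"

definition out_dim :: "network \<Rightarrow> nat" where
  "out_dim N = width N (depth N + 1)"

definition n_phi :: "network \<Rightarrow> nat" where
  "n_phi N = (\<Sum>i=1..depth N. width N i)"

primrec layer_out :: "network \<Rightarrow> real vec \<Rightarrow> nat \<Rightarrow> real vec" where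
  "layer_out N x 0 = x"
| "layer_out N x (Suc i) =
     map_vec (activation N) (weight N (Suc i) *\<^sub>v layer_out N x i + bias N (Suc i))"

text \<open>\<open>layer_in N x i\<close> is \<open>v\<^sup>i\<close> for \<open>i \<ge> 1\<close>, and \<open>layer_out N x i\<close> is \<open>w\<^sup>i\<close>.\<close>

definition layer_in :: "network \<Rightarrow> real vec \<Rightarrow> nat \<Rightarrow> real vec" where
  "layer_in N x i = weight N i *\<^sub>v layer_out N x (i - 1) + bias N i"

definition net_map :: "network \<Rightarrow> real vec \<Rightarrow> real vec" where
  "net_map N x =
     weight N (depth N + 1) *\<^sub>v layer_out N x (depth N) + bias N (depth N + 1)"

definition v_phi :: "network \<Rightarrow> real vec \<Rightarrow> real vec" where
  "v_phi N x = stack (layer_in N x) (depth N)"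

definition w_phi :: "network \<Rightarrow> real vec \<Rightarrow> real vec" where
  "w_phi N x = stack (layer_out N x) (depth N)"

definition N_vx :: "network \<Rightarrow> real mat" where
  "N_vx N = vcat (in_dim N)
     (\<lambda>i. if i = 1 then weight N 1 else 0\<^sub>m (width N i) (in_dim N)) (depth N)"

definition N_vw :: "network \<Rightarrow> real mat" where
  "N_vw N = vcat (n_phi N)
     (\<lambda>i. hcat (width N i)
        (\<lambda>j. if i = j + 1 then weight N i else 0\<^sub>m (width N i) (width N j)) (depth N))
     (depth N)"

definition N_ux :: "network \<Rightarrow> real mat" where
  "N_ux N = 0\<^sub>m (out_dim N) (in_dim N)"

definition N_uw :: "network \<Rightarrow> real mat" where
  "N_uw N = hcat (out_dim N)
     (\<lambda>j. if j = depth N then weight N (depth N + 1) else 0\<^sub>m (out_dim N) (width N j))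
     (depth N)"

definition locally_sector_bounded ::
    "(real \<Rightarrow> real) \<Rightarrow> real \<Rightarrow> real \<Rightarrow> real \<Rightarrow> real \<Rightarrow> real \<Rightarrow> bool" where
  "locally_sector_bounded f a b vs vlo vhi \<longleftrightarrow> vs \<in> {vlo..vhi} \<and>
     (\<forall>v\<in>{vlo..vhi}. ((f v - f vs) - a * (v - vs)) * ((f v - f vs) - b * (v - vs)) \<le> 0)"

record plant =
  A_lo :: "real mat"
  A_hi :: "real mat"
  B_lo :: "real mat"
  B_hi :: "real mat"

definition wf_plant :: "plant \<Rightarrow> nat \<Rightarrow> nat \<Rightarrow> bool" where
  "wf_plant S n m \<longleftrightarrow>
     A_lo S \<in> carrier_mat n n \<and> A_hi S \<in> carrier_mat n n \<and> A_lo S \<le> A_hi S \<and>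
     B_lo S \<in> carrier_mat n m \<and> B_hi S \<in> carrier_mat n m \<and> B_lo S \<le> B_hi S"

primrec trajectory :: "(real vec \<Rightarrow> real vec) \<Rightarrow> nat \<Rightarrow> real vec \<Rightarrow> real vec" where
  "trajectory f 0 x0 = x0"
| "trajectory f (Suc t) x0 = f (trajectory f t x0)"

definition closed_loop :: "network \<Rightarrow> real mat \<Rightarrow> real mat \<Rightarrow> real vec \<Rightarrow> real vec" where
  "closed_loop N A B x = A *\<^sub>v x + B *\<^sub>v net_map N x"

definition lyapunov_stable :: "nat \<Rightarrow> (real vec \<Rightarrow> real vec) \<Rightarrow> real vec \<Rightarrow> bool" where
  "lyapunov_stable n f xs \<longleftrightarrow> f xs = xs \<and>
     (\<forall>\<epsilon>>0. \<exists>\<delta>>0. \<forall>x0\<in>carrier_vec n. vnorm (x0 - xs) < \<delta> \<longrightarrow>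
        (\<forall>t. vnorm (trajectory f t x0 - xs) < \<epsilon>))"

definition locally_stable :: "network \<Rightarrow> plant \<Rightarrow> real vec \<Rightarrow> bool" where
  "locally_stable N S xs \<longleftrightarrow>
     (\<forall>A\<in>{A_lo S..A_hi S}. \<forall>B\<in>{B_lo S..B_hi S}.
        lyapunov_stable (in_dim N) (closed_loop N A B) xs)"

definition robust_roa :: "network \<Rightarrow> plant \<Rightarrow> real vec \<Rightarrow> real vec set" where
  "robust_roa N S xs = {x \<in> carrier_vec (in_dim N).
     \<forall>A\<in>{A_lo S..A_hi S}. \<forall>B\<in>{B_lo S..B_hi S}.
       (\<lambda>t. vnorm (trajectory (closed_loop N A B) t x - xs)) \<longlonglongrightarrow> 0}"

definition ellipsoid :: "real mat \<Rightarrow> real vec \<Rightarrow> real vec set" where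
  "ellipsoid P xs = {x \<in> carrier_vec (dim_row P). (x - xs) \<bullet> (P *\<^sub>v (x - xs)) \<le> 1}"

definition R_V :: "network \<Rightarrow> real mat" where
  "R_V N = four_block_mat (1\<^sub>m (in_dim N)) (0\<^sub>m (in_dim N) (n_phi N)) (N_ux N) (N_uw N)"

definition R_phi :: "network \<Rightarrow> real mat" where
  "R_phi N = four_block_mat (N_vx N) (N_vw N) (0\<^sub>m (n_phi N) (in_dim N)) (1\<^sub>m (n_phi N))"

definition Psi_phi :: "nat \<Rightarrow> real vec \<Rightarrow> real vec \<Rightarrow> real mat" where
  "Psi_phi k \<alpha> \<beta> = four_block_mat (diag_of_vec \<beta>) (- 1\<^sub>m k) (- diag_of_vec \<alpha>) (1\<^sub>m k)"

definition M_phi :: "nat \<Rightarrow> real vec \<Rightarrow> real mat" where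
  "M_phi k lam = four_block_mat (0\<^sub>m k k) (diag_of_vec lam) (diag_of_vec lam) (0\<^sub>m k k)"

definition X_mat :: "network \<Rightarrow> real vec \<Rightarrow> real vec \<Rightarrow> real vec \<Rightarrow> real mat" where
  "X_mat N \<alpha> \<beta> lam =
     transpose_mat (R_phi N) * transpose_mat (Psi_phi (n_phi N) \<alpha> \<beta>) * M_phi (n_phi N) lam *
     Psi_phi (n_phi N) \<alpha> \<beta> * R_phi N"

definition A_0 :: "plant \<Rightarrow> real mat" where
  "A_0 S = (1/2) \<cdot>\<^sub>m (A_hi S + A_lo S)"

definition A_r :: "plant \<Rightarrow> real mat" where
  "A_r S = (1/2) \<cdot>\<^sub>m (A_hi S - A_lo S)"

definition BN_lo :: "network \<Rightarrow> plant \<Rightarrow> real mat" where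
  "BN_lo N S = mat (in_dim N) (n_phi N)
     (\<lambda>(i, j). INF B\<in>{B_lo S..B_hi S}. (B * N_uw N) $$ (i, j))"

definition BN_hi :: "network \<Rightarrow> plant \<Rightarrow> real mat" where
  "BN_hi N S = mat (in_dim N) (n_phi N)
     (\<lambda>(i, j). SUP B\<in>{B_lo S..B_hi S}. (B * N_uw N) $$ (i, j))"

definition B_0 :: "network \<Rightarrow> plant \<Rightarrow> real mat" where
  "B_0 N S = (1/2) \<cdot>\<^sub>m (BN_hi N S + BN_lo N S)"

definition B_r :: "network \<Rightarrow> plant \<Rightarrow> real mat" where
  "B_r N S = (1/2) \<cdot>\<^sub>m (BN_hi N S - BN_lo N S)"

definition n_hat :: "network \<Rightarrow> nat" where
  "n_hat N = 2 * in_dim N + n_phi N"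

definition D_mat :: "network \<Rightarrow> plant \<Rightarrow> real mat" where
  "D_mat N S = transpose_mat (A_r S @\<^sub>c B_r N S @\<^sub>c 0\<^sub>m (in_dim N) (in_dim N))"

definition Z_mat ::
    "network \<Rightarrow> plant \<Rightarrow> real vec \<Rightarrow> real vec \<Rightarrow> real vec \<Rightarrow> real mat \<Rightarrow> real mat" where
  "Z_mat N S \<alpha> \<beta> lam P =
     (let n = in_dim N; m = out_dim N; L = P * (A_0 S @\<^sub>c B_0 N S)
      in four_block_mat
        (- (transpose_mat (R_V N) * (1\<^sub>m n @\<^sub>r 0\<^sub>m m n) * P * (1\<^sub>m n @\<^sub>c 0\<^sub>m n m) * R_V N)
           + X_mat N \<alpha> \<beta> lam)
        (transpose_mat L) L (- P))"

text \<open>The matrix \<open>\<Sum>i j. \<gamma>\<^sub>i\<^sub>j D(i,j)\<^sup>2 e\<^sub>i e\<^sub>i\<^sup>T\<close>, written out entrywise.\<close>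

definition Gam_mat :: "network \<Rightarrow> plant \<Rightarrow> (nat \<Rightarrow> nat \<Rightarrow> real) \<Rightarrow> real mat" where
  "Gam_mat N S \<gamma> = mat (n_hat N) (n_hat N) (\<lambda>(r, c).
     \<Sum>i<n_hat N. \<Sum>j<in_dim N.
       \<gamma> i j * (D_mat N S $$ (i, j))\<^sup>2 * (unit_vec (n_hat N) i $ r * unit_vec (n_hat N) i $ c))"

text \<open>Position \<open>k = i * n + j\<close> on the diagonal of \<open>V\<close> carries \<open>\<gamma>\<^sub>i\<^sub>j\<close>.\<close>

definition V_mat :: "network \<Rightarrow> (nat \<Rightarrow> nat \<Rightarrow> real) \<Rightarrow> real mat" where
  "V_mat N \<gamma> = mat_diag (n_hat N * in_dim N) (\<lambda>k. \<gamma> (k div in_dim N) (k mod in_dim N))"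

definition U_mat :: "network \<Rightarrow> real mat \<Rightarrow> real mat" where
  "U_mat N P = hcat (n_hat N) (\<lambda>_. 0\<^sub>m (in_dim N + n_phi N) (in_dim N) @\<^sub>r P) (n_hat N)"

definition cond_N :: "network \<Rightarrow> real vec \<Rightarrow> real mat \<Rightarrow> bool" where
  "cond_N N vbar1 P \<longleftrightarrow> (\<forall>i<width N 1.
     let w = mat_of_row (row (weight N 1) i);
         d = vbar1 $ i - layer_in N (0\<^sub>v (in_dim N)) 1 $ i
     in pos_semidef (four_block_mat (mat 1 1 (\<lambda>_. d\<^sup>2)) w (transpose_mat w) P))"

definition LMI_base :: "network \<Rightarrow> real vec \<Rightarrow> real mat \<Rightarrow> real vec \<Rightarrow> bool" where
  "LMI_base N vbar1 P lam \<longleftrightarrow>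
     P \<in> carrier_mat (in_dim N) (in_dim N) \<and> pos_def P \<and>
     lam \<in> carrier_vec (n_phi N) \<and> 0\<^sub>v (n_phi N) \<le> lam \<and>
     cond_N N vbar1 P"

definition LMI_I ::
    "network \<Rightarrow> plant \<Rightarrow> real vec \<Rightarrow> real vec \<Rightarrow> real vec \<Rightarrow> real mat \<Rightarrow> bool" where
  "LMI_I N S vbar1 \<alpha> \<beta> P \<longleftrightarrow>
     (let n = in_dim N; h = n_hat N in
      \<exists>lam \<gamma>. LMI_base N vbar1 P lam \<and> (\<forall>i<h. \<forall>j<n. \<gamma> i j > 0) \<and>
        four_block_mat (Z_mat N S \<alpha> \<beta> lam P + Gam_mat N S \<gamma>) (U_mat N P)
          (transpose_mat (U_mat N P)) (- V_mat N \<gamma>) \<prec> 0\<^sub>m (h + h * n) (h + h * n))"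

definition LMI_II ::
    "network \<Rightarrow> plant \<Rightarrow> real vec \<Rightarrow> real vec \<Rightarrow> real vec \<Rightarrow> real mat \<Rightarrow> bool" where
  "LMI_II N S vbar1 \<alpha> \<beta> P \<longleftrightarrow>
     (let n = in_dim N; h = n_hat N; L = 0\<^sub>m n (n + n_phi N) @\<^sub>c P in
      \<exists>lam T Q. LMI_base N vbar1 P lam \<and>
        T \<in> carrier_mat h h \<and> diagonal_mat T \<and> Q \<in> carrier_mat n n \<and> diagonal_mat Q \<and>
        D_mat N S * Q * transpose_mat (D_mat N S) \<prec> T \<and>
        four_block_mat (Z_mat N S \<alpha> \<beta> lam P + T) (transpose_mat L) L (- Q)
          \<prec> 0\<^sub>m (h + n) (h + n))"

definition LMI_III ::
    "network \<Rightarrow> plant \<Rightarrow> real vec \<Rightarrow> real vec \<Rightarrow> real vec \<Rightarrow> real mat \<Rightarrow> bool" where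
  "LMI_III N S vbar1 \<alpha> \<beta> P \<longleftrightarrow>
     (let n = in_dim N; h = n_hat N in
      \<exists>lam \<gamma> Y. LMI_base N vbar1 P lam \<and> (\<forall>i<h. \<forall>j<n. \<gamma> i j > 0) \<and>
        Y \<in> carrier_mat h h \<and> symmetric_mat Y \<and>
        Y \<prec> - Z_mat N S \<alpha> \<beta> lam P \<and>
        0\<^sub>m (h + h * n) (h + h * n) \<prec>
          four_block_mat (Y - Gam_mat N S \<gamma>) (U_mat N P) (transpose_mat (U_mat N P)) (V_mat N \<gamma>))"

text \<open>The matrices \<open>N\<^sub>v\<^sub>x, N\<^sub>v\<^sub>w, N\<^sub>u\<^sub>x, N\<^sub>u\<^sub>w\<close> satisfy the equations that determine them,
  \<open>v\<^sub>\<phi> = N\<^sub>v\<^sub>x x + N\<^sub>v\<^sub>w w\<^sub>\<phi> + N\<^sub>v\<^sub>b\<close> and \<open>\<pi>(x) = N\<^sub>u\<^sub>x x + N\<^sub>u\<^sub>w w\<^sub>\<phi> + N\<^sub>u\<^sub>b\<close>.\<close>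

lemma append_cols_carrier: "A \<in> carrier_mat r c1 \<Longrightarrow> B \<in> carrier_mat r c2 \<Longrightarrow>
  A @\<^sub>c B \<in> carrier_mat r (c1 + c2)"
  by (auto simp: append_cols_def four_block_mat_def Let_def)

lemma hcat_carrier: "\<forall>i\<in>{1..k}. B i \<in> carrier_mat r (c i) \<Longrightarrow> hcat r B k \<in> carrier_mat r (\<Sum>i=1..k. c i)"
proof (induction k)
  case (Suc k)
  then have "hcat r B k \<in> carrier_mat r (\<Sum>i=1..k. c i)" "B (Suc k) \<in> carrier_mat r (c (Suc k))" by auto
  from append_cols_carrier[OF this] show ?case by simp
qed simp

lemma vcat_carrier: "\<forall>i\<in>{1..k}. B i \<in> carrier_mat (r i) c \<Longrightarrow> vcat c B k \<in> carrier_mat (\<Sum>i=1..k. r i) c"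
proof (induction k)
  case (Suc k)
  then have "vcat c B k \<in> carrier_mat (\<Sum>i=1..k. r i) c" "B (Suc k) \<in> carrier_mat (r (Suc k)) c" by auto
  from carrier_append_rows[OF this] show ?case by simp
qed simp

lemma stack_carrier: "\<forall>i\<in>{1..k}. v i \<in> carrier_vec (r i) \<Longrightarrow> stack v k \<in> carrier_vec (\<Sum>i=1..k. r i)"
proof (induction k)
  case (Suc k)
  then have "stack v k \<in> carrier_vec (\<Sum>i=1..k. r i)" "v (Suc k) \<in> carrier_vec (r (Suc k))" by auto
  from append_carrier_vec[OF this] show ?case by simp
qed simp

lemma append_cols_mult_vec:
  assumes "A \<in> carrier_mat r c1" "B \<in> carrier_mat r c2" "v \<in> carrier_vec c1" "w \<in> carrier_vec c2"
  shows "(A @\<^sub>c B) *\<^sub>v (v @\<^sub>v w) = A *\<^sub>v v + B *\<^sub>v w"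
proof -
  have "(A @\<^sub>c B) *\<^sub>v (v @\<^sub>v w) = (A *\<^sub>v v + B *\<^sub>v w) @\<^sub>v (0\<^sub>m 0 c1 *\<^sub>v v + 0\<^sub>m 0 c2 *\<^sub>v w)"
    unfolding append_cols_def using assms
    by (subst four_block_mat_mult_vec[of _ r c1 _ c2 _ 0]) auto
  then show ?thesis using assms by (intro eq_vecI) auto
qed

lemma vcat_mult_vec:
  assumes "\<forall>i\<in>{1..k}. B i \<in> carrier_mat (r i) c" "v \<in> carrier_vec c"
  shows "vcat c B k *\<^sub>v v = stack (\<lambda>i. B i *\<^sub>v v) k"
  using assms(1)
proof (induction k)
  case 0 show ?case using assms by (intro eq_vecI) auto
next
  case (Suc k)
  have "vcat c B k \<in> carrier_mat (\<Sum>i=1..k. r i) c" using Suc by (intro vcat_carrier) auto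
  moreover have "B (Suc k) \<in> carrier_mat (r (Suc k)) c" using Suc by auto
  ultimately have "(vcat c B k @\<^sub>r B (Suc k)) *\<^sub>v v = vcat c B k *\<^sub>v v @\<^sub>v B (Suc k) *\<^sub>v v"
    using assms(2) by (rule mat_mult_append)
  then show ?case using Suc by simp
qed

lemma hcat_mult_stack_zero:
  assumes "\<forall>i\<in>{1..k}. c' i = 0\<^sub>m r (c i)" "\<forall>i\<in>{1..k}. v i \<in> carrier_vec (c i)"
  shows "hcat r c' k *\<^sub>v stack v k = 0\<^sub>v r"
  using assms
proof (induction k)
  case 0 show ?case by (intro eq_vecI) (auto simp: scalar_prod_def)
next
  case (Suc k)
  have "hcat r c' k \<in> carrier_mat r (\<Sum>i=1..k. c i)" using Suc by (intro hcat_carrier) auto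
  moreover have "stack v k \<in> carrier_vec (\<Sum>i=1..k. c i)" using Suc by (intro stack_carrier) auto
  ultimately have "hcat r c' (Suc k) *\<^sub>v stack v (Suc k) = hcat r c' k *\<^sub>v stack v k + c' (Suc k) *\<^sub>v v (Suc k)"
    using Suc by (simp add: append_cols_mult_vec[of _ r _ _ "c (Suc k)"])
  then show ?case using Suc by auto
qed

lemma hcat_mult_stack_single:
  assumes "\<forall>i\<in>{1..k}. M i = (if i = p then W else 0\<^sub>m r (c i))" "\<forall>i\<in>{1..k}. v i \<in> carrier_vec (c i)"
   "p \<in> {1..k}" "W \<in> carrier_mat r (c p)"
  shows "hcat r M k *\<^sub>v stack v k = W *\<^sub>v v p"
  using assms
proof (induction k)
  case (Suc k)
  have "hcat r M k \<in> carrier_mat r (\<Sum>i=1..k. c i)" using Suc by (intro hcat_carrier) auto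
  moreover have "stack v k \<in> carrier_vec (\<Sum>i=1..k. c i)" using Suc by (intro stack_carrier) auto
  moreover have "M (Suc k) \<in> carrier_mat r (c (Suc k))" using Suc by auto
  ultimately have *: "hcat r M (Suc k) *\<^sub>v stack v (Suc k) = hcat r M k *\<^sub>v stack v k + M (Suc k) *\<^sub>v v (Suc k)"
    using Suc by (simp add: append_cols_mult_vec[of _ r _ _ "c (Suc k)"])
  show ?case
  proof (cases "p = Suc k")
    case True
    have "hcat r M k *\<^sub>v stack v k = 0\<^sub>v r" using Suc True by (intro hcat_mult_stack_zero[of _ _ _ c]) auto
    then show ?thesis using * Suc True by (auto intro!: eq_vecI)
  next
    case False
    then have "hcat r M k *\<^sub>v stack v k = W *\<^sub>v v p" using Suc by auto
    then show ?thesis using * Suc False by (auto intro!: eq_vecI)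
  qed
qed simp

lemma stack_add:
  assumes "\<forall>i\<in>{1..k}. v i \<in> carrier_vec (c i)" "\<forall>i\<in>{1..k}. w i \<in> carrier_vec (c i)"
  shows "stack (\<lambda>i. v i + w i) k = stack v k + stack w k"
  using assms
proof (induction k)
  case (Suc k)
  have "stack v k \<in> carrier_vec (\<Sum>i=1..k. c i)" "stack w k \<in> carrier_vec (\<Sum>i=1..k. c i)" using Suc.prems by (intro stack_carrier; auto)+
  moreover have "v (Suc k) \<in> carrier_vec (c (Suc k))" "w (Suc k) \<in> carrier_vec (c (Suc k))" using Suc.prems by auto
  moreover have "stack (\<lambda>i. v i + w i) k = stack v k + stack w k" using Suc by auto
  ultimately show ?case by (simp add: append_vec_add[of _ "\<Sum>i=1..k. c i" _ _ "c (Suc k)"])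
qed auto

lemma stack_cong: "\<forall>i\<in>{1..k}. v i = w i \<Longrightarrow> stack v k = stack w k"
  by (induction k) auto

lemma layer_out_carrier:
  assumes "wf_network N" "x \<in> carrier_vec (in_dim N)" "i \<le> depth N"
  shows "layer_out N x i \<in> carrier_vec (width N i)"
  using assms(3)
proof (induction i)
  case (Suc i)
  then have "bias N (Suc i) \<in> carrier_vec (width N (Suc i))" using assms(1) by (auto simp: wf_network_def)
  then show ?case by (auto simp: map_vec_def)
qed (use assms in \<open>auto simp: in_dim_def\<close>)

lemma v_phi_eq:
  assumes N: "wf_network N" and x: "x \<in> carrier_vec (in_dim N)"
  shows "v_phi N x = (N_vx N *\<^sub>v x + N_vw N *\<^sub>v w_phi N x) + stack (bias N) (depth N)"
proof -
  let ?l = "depth N"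
  have W: "\<forall>i\<in>{1..?l}. weight N i \<in> carrier_mat (width N i) (width N (i-1)) \<and> bias N i \<in> carrier_vec (width N i)"
    using N by (auto simp: wf_network_def)
  have lo: "\<forall>i\<in>{1..?l}. layer_out N x i \<in> carrier_vec (width N i)" using layer_out_carrier[OF N x] by auto
  have w: "w_phi N x \<in> carrier_vec (n_phi N)" unfolding w_phi_def n_phi_def by (rule stack_carrier[OF lo])
  let ?a = "\<lambda>i. (if i = 1 then weight N 1 else 0\<^sub>m (width N i) (in_dim N))"
  have ac: "\<forall>i\<in>{1..?l}. ?a i \<in> carrier_mat (width N i) (in_dim N)" using W by (force simp: in_dim_def)
  have a: "N_vx N *\<^sub>v x = stack (\<lambda>i. ?a i *\<^sub>v x) ?l"
    unfolding N_vx_def by (rule vcat_mult_vec[OF ac x])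
  let ?b = "\<lambda>i. hcat (width N i)
        (\<lambda>j. if i = j + 1 then weight N i else 0\<^sub>m (width N i) (width N j)) ?l"
  have bc: "\<forall>i\<in>{1..?l}. ?b i \<in> carrier_mat (width N i) (n_phi N)"
    unfolding n_phi_def by (intro ballI hcat_carrier) (use W in force)
  have b: "N_vw N *\<^sub>v w_phi N x = stack (\<lambda>i. ?b i *\<^sub>v w_phi N x) ?l"
    unfolding N_vw_def by (rule vcat_mult_vec[OF bc w])
  have "v_phi N x = stack (\<lambda>i. (?a i *\<^sub>v x + ?b i *\<^sub>v w_phi N x) + bias N i) ?l"
    unfolding v_phi_def
  proof (rule stack_cong, rule ballI)
    fix i assume i: "i \<in> {1..?l}"
    show "layer_in N x i = (?a i *\<^sub>v x + ?b i *\<^sub>v w_phi N x) + bias N i"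
    proof (cases "i = 1")
      case True
      have z: "?b i *\<^sub>v w_phi N x = 0\<^sub>v (width N i)" unfolding w_phi_def
        by (rule hcat_mult_stack_zero[of _ _ _ "width N"]) (use True lo in auto)
      have "weight N 1 \<in> carrier_mat (width N 1) (width N 0)" using W i True by force
      then have "weight N 1 *\<^sub>v x \<in> carrier_vec (width N 1)"
        using x unfolding in_dim_def by (rule mult_mat_vec_carrier)
      then have "weight N 1 *\<^sub>v x + 0\<^sub>v (width N 1) = weight N 1 *\<^sub>v x" by (rule right_zero_vec)
      then show ?thesis unfolding z using True by (simp add: layer_in_def)
    next
      case False
      have z: "?b i *\<^sub>v w_phi N x = weight N i *\<^sub>v layer_out N x (i - 1)" unfolding w_phi_def
        by (rule hcat_mult_stack_single[of _ _ "i - 1" _ _ "width N"]) (use False lo i W in auto)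
      have "weight N i *\<^sub>v layer_out N x (i - 1) \<in> carrier_vec (width N i)"
        by (rule mult_mat_vec_carrier[of _ _ "width N (i - 1)"]) (use W i layer_out_carrier[OF N x] in auto)
      moreover have "0\<^sub>m (width N i) (in_dim N) *\<^sub>v x = 0\<^sub>v (width N i)" using x by auto
      ultimately show ?thesis unfolding z using False by (simp add: layer_in_def)
    qed
  qed
  also have "\<dots> = stack (\<lambda>i. ?a i *\<^sub>v x + ?b i *\<^sub>v w_phi N x) ?l + stack (bias N) ?l"
    by (rule stack_add[of _ _ "width N"])
      (use W ac bc x w in \<open>blast intro: add_carrier_vec mult_mat_vec_carrier\<close>)+
  also have "stack (\<lambda>i. ?a i *\<^sub>v x + ?b i *\<^sub>v w_phi N x) ?l = stack (\<lambda>i. ?a i *\<^sub>v x) ?l + stack (\<lambda>i. ?b i *\<^sub>v w_phi N x) ?l"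
    by (rule stack_add[of _ _ "width N"]) (use ac bc x w in \<open>blast intro: mult_mat_vec_carrier\<close>)+
  finally show ?thesis unfolding a b .
qed

lemma net_map_eq:
  assumes N: "wf_network N" and x: "x \<in> carrier_vec (in_dim N)"
  shows "net_map N x = (N_ux N *\<^sub>v x + N_uw N *\<^sub>v w_phi N x) + bias N (depth N + 1)"
proof -
  have lo: "\<forall>i\<in>{1..depth N}. layer_out N x i \<in> carrier_vec (width N i)" using layer_out_carrier[OF N x] by auto
  have W: "weight N (depth N + 1) \<in> carrier_mat (out_dim N) (width N (depth N))" "bias N (depth N + 1) \<in> carrier_vec (out_dim N)"
    using N by (force simp: wf_network_def out_dim_def)+
  have "N_uw N *\<^sub>v w_phi N x = weight N (depth N + 1) *\<^sub>v layer_out N x (depth N)"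
    unfolding N_uw_def w_phi_def
    by (rule hcat_mult_stack_single[of _ _ _ _ _ "width N"]) (use lo N W in \<open>auto simp: wf_network_def\<close>)
  then show ?thesis using W x by (auto simp: net_map_def N_ux_def intro!: eq_vecI)
qed

lemma w_phi_eq:
  assumes N: "wf_network N" and x: "x \<in> carrier_vec (in_dim N)"
  shows "w_phi N x = map_vec (activation N) (v_phi N x)"
proof -
  have m: "map_vec f (stack v k) = stack (\<lambda>i. map_vec f (v i)) k" for f :: "real \<Rightarrow> real" and v k
  proof (induction k)
    case (Suc k)
    have "map_vec f (a @\<^sub>v b) = map_vec f a @\<^sub>v map_vec f b" for a b by (intro eq_vecI) auto
    then show ?case using Suc by simp
  qed (auto intro!: eq_vecI)
  have "layer_out N x i = map_vec (activation N) (layer_in N x i)" if "i \<ge> 1" for i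
    using that by (cases i) (auto simp: layer_in_def)
  then show ?thesis unfolding w_phi_def v_phi_def m by (intro stack_cong) auto
qed

end

theory Submission
  imports Defs "Jordan_Normal_Form.Determinant"
begin

text \<open>
  The function \<open>V(x) = x \<bullet> P x\<close> is a common Lyapunov function for all plants in the interval family.
  Write \<open>w = w\<^sub>\<phi>(x) - w\<^sub>*\<close>. Since \<open>\<pi>(0) = 0\<close>, the biases cancel and the successor of \<open>x\<close> is
  \<open>y = A x + B N\<^sub>u\<^sub>w w\<close>. Three observations give \<open>V(y) - V(x) \<le> - \<epsilon> (x \<bullet> x)\<close> on the ellipsoid
  \<open>V \<le> 1\<close>.

  First, the quadratic form of \<open>Z\<close> at \<open>\<zeta> = (x, w, y)\<close> is \<open>V(y) - V(x)\<close> plus the form of \<open>X(\<lambda>)\<close> at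
  \<open>(x, w)\<close>, if the plant is the centre \<open>(A\<^sub>0, B\<^sub>0)\<close> of the family. For another plant, the
  deviation \<open>E = [A - A\<^sub>0, B N\<^sub>u\<^sub>w - B\<^sub>0, 0]\<close> adds \<open>2 (P y) \<bullet> (E \<zeta>)\<close>
  (\<open>robust_Lyapunov_decrease\<close>).

  Second, each system of matrix inequalities makes the sum of both terms at most
  \<open>- \<epsilon> (\<zeta> \<bullet> \<zeta>)\<close> for all \<open>E\<close> with \<open>\<bar>E\<bar> \<le> D\<^sup>T\<close>. To see this, test the large matrix at \<open>(\<zeta>, \<eta>)\<close>,
  where \<open>\<eta>\<close> consists of the products \<open>E\<^sub>j\<^sub>i \<zeta>\<^sub>i\<close> for (I), of their negatives for (III), and is
  \<open>E \<zeta>\<close> for (II). The off-diagonal block then produces the uncertain term, and the diagonal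
  multipliers leave a remainder of the right sign because \<open>\<bar>E\<bar> \<le> D\<^sup>T\<close> (\<open>V_mat_entry_contributions_le\<close>,
  \<open>diagonal_multiplier_bound\<close>). A positive \<open>\<epsilon>\<close> exists because a definite form is coercive
  (\<open>pos_def_lower_bound\<close>).

  Third, condition (N) keeps the first-layer inputs at points of the ellipsoid in the box where the
  sector bounds hold, so the form of \<open>X(\<lambda>)\<close> is nonnegative there (\<open>first_layer_in_bounds\<close>,
  \<open>quad_X_mat_nonneg_if_sector\<close>).

  The decrease yields \<open>V(y) \<le> \<rho> V(x)\<close> with a fixed \<open>\<rho> < 1\<close>, hence geometric decay of trajectories
  that start in the ellipsoid, and both claims follow (\<open>quadratic_Lyapunov_stable\<close>).
\<close>

section \<open>Quadratic forms\<close>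

abbreviation quad :: "real mat \<Rightarrow> real vec \<Rightarrow> real" where
  "quad M x \<equiv> x \<bullet> (M *\<^sub>v x)"

lemma scalar_prod_self_sum:
  fixes x :: "real vec"
  shows "x \<in> carrier_vec k \<Longrightarrow> x \<bullet> x = (\<Sum>i<k. (x $ i)\<^sup>2)"
  by (auto simp: scalar_prod_def power2_eq_square lessThan_atLeast0)

lemma scalar_prod_self_nonneg: "(x :: real vec) \<bullet> x \<ge> 0"
  by (auto simp: scalar_prod_def intro!: sum_nonneg)

lemma quad_add:
  assumes "A \<in> carrier_mat k k" "B \<in> carrier_mat k k" "x \<in> carrier_vec k"
  shows "quad (A + B) x = quad A x + quad B x"
  using assms by (simp add: add_mult_distrib_mat_vec[of _ k k] scalar_prod_add_distrib[of _ k])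

lemma quad_uminus:
  assumes "A \<in> carrier_mat k k" "x \<in> carrier_vec k"
  shows "quad (- A) x = - quad A x"
  using assms by (simp add: uminus_mult_mat_vec)

lemma quad_minus:
  assumes "A \<in> carrier_mat k k" "B \<in> carrier_mat k k" "x \<in> carrier_vec k"
  shows "quad (A - B) x = quad A x - quad B x"
  using assms by (simp add: minus_mult_distrib_mat_vec[of _ k k] scalar_prod_minus_distrib[of _ k])

lemma scalar_prod_transpose_mult_vec:
  fixes A :: "real mat"
  assumes "A \<in> carrier_mat r c" "x \<in> carrier_vec c" "y \<in> carrier_vec r"
  shows "x \<bullet> (transpose_mat A *\<^sub>v y) = y \<bullet> (A *\<^sub>v x)"
proof -
  have "x \<bullet> (transpose_mat A *\<^sub>v y) = (transpose_mat A *\<^sub>v y) \<bullet> x"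
    using assms by (intro comm_scalar_prod[of _ c]) auto
  then show ?thesis using transpose_vec_mult_scalar[OF assms] by simp
qed

lemma quad_four_block:
  assumes "A \<in> carrier_mat k k" "B \<in> carrier_mat k l" "C \<in> carrier_mat l k" "D \<in> carrier_mat l l"
    and "x \<in> carrier_vec k" "y \<in> carrier_vec l"
  shows "quad (four_block_mat A B C D) (x @\<^sub>v y) = quad A x + x \<bullet> (B *\<^sub>v y) + y \<bullet> (C *\<^sub>v x) + quad D y"
proof -
  have "four_block_mat A B C D *\<^sub>v (x @\<^sub>v y) = (A *\<^sub>v x + B *\<^sub>v y) @\<^sub>v (C *\<^sub>v x + D *\<^sub>v y)"
    by (rule four_block_mat_mult_vec) fact+
  moreover have "(x @\<^sub>v y) \<bullet> \<dots> = x \<bullet> (A *\<^sub>v x + B *\<^sub>v y) + y \<bullet> (C *\<^sub>v x + D *\<^sub>v y)"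
    using assms by (intro scalar_prod_append) auto
  ultimately show ?thesis using assms
    by (simp add: scalar_prod_add_distrib[of _ k] scalar_prod_add_distrib[of _ l])
qed

text \<open>The off-diagonal block contributes twice, which is where the factor 2 in every
  expanded matrix inequality comes from.\<close>

lemma quad_four_block_sym:
  assumes "A \<in> carrier_mat k k" "C \<in> carrier_mat l k" "D \<in> carrier_mat l l"
    and "x \<in> carrier_vec k" "y \<in> carrier_vec l"
  shows "quad (four_block_mat A (transpose_mat C) C D) (x @\<^sub>v y) = quad A x + 2 * (y \<bullet> (C *\<^sub>v x)) + quad D y"
proof -
  have "transpose_mat C \<in> carrier_mat k l" using assms by auto
  note quad_four_block[OF assms(1) this assms(2-5)]
  then show ?thesis using scalar_prod_transpose_mult_vec[OF assms(2,4,5)] by simp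
qed

lemma mat_diag_mult_vec:
  assumes "x \<in> carrier_vec k"
  shows "mat_diag k f *\<^sub>v x = vec k (\<lambda>i. f i * x $ i :: real)"
proof (rule eq_vecI)
  fix i assume "i < dim_vec (vec k (\<lambda>i. f i * x $ i))"
  then have i: "i < k" by simp
  have "(mat_diag k f *\<^sub>v x) $ i = (\<Sum>j<k. (if i = j then f j else 0) * x $ j)"
    using i assms by (simp add: scalar_prod_def lessThan_atLeast0 mat_diag_def)
  also have "\<dots> = (\<Sum>j<k. if i = j then f j * x $ j else 0)" by (intro sum.cong) auto
  finally show "(mat_diag k f *\<^sub>v x) $ i = vec k (\<lambda>i. f i * x $ i) $ i" using i by simp
qed (simp add: mat_diag_def)

lemma quad_mat_diag:
  assumes "x \<in> carrier_vec k"
  shows "quad (mat_diag k f) x = (\<Sum>i<k. f i * (x $ i)\<^sup>2)"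
  unfolding mat_diag_mult_vec[OF assms]
  by (auto simp: scalar_prod_def lessThan_atLeast0 power2_eq_square intro!: sum.cong)

lemma pos_semidef_if_pos_def: "pos_def M \<Longrightarrow> pos_semidef M"
  unfolding pos_def_def pos_semidef_def
  by (metis less_eq_real_def scalar_prod_left_zero mult_mat_vec_carrier carrier_matI symmetric_mat_def square_mat.simps)

lemma symmetric_mat_scalar_prod_swap:
  assumes "symmetric_mat M" "M \<in> carrier_mat k k" "x \<in> carrier_vec k" "y \<in> carrier_vec k"
  shows "x \<bullet> (M *\<^sub>v y) = y \<bullet> (M *\<^sub>v x)"
  using scalar_prod_transpose_mult_vec[OF assms(2-4)] assms(1) by (simp add: symmetric_mat_def)

text \<open>The quadratic form is nonnegative on the line \<open>x + t y\<close>, so its discriminant in \<open>t\<close> is not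
  positive.\<close>

lemma pos_semidef_Cauchy_Schwarz:
  assumes "pos_semidef M" "M \<in> carrier_mat k k" "x \<in> carrier_vec k" "y \<in> carrier_vec k"
  shows "(y \<bullet> (M *\<^sub>v x))\<^sup>2 \<le> quad M y * quad M x"
proof -
  have sym: "symmetric_mat M" using assms by (simp add: pos_semidef_def)
  have nonneg: "quad M v \<ge> 0" if "v \<in> carrier_vec k" for v
    using assms that unfolding pos_semidef_def by auto
  let ?a = "quad M y" and ?b = "y \<bullet> (M *\<^sub>v x)" and ?c = "quad M x"
  have line: "?c + 2 * t * ?b + t\<^sup>2 * ?a \<ge> 0" for t
  proof -
    have "quad M (x + t \<cdot>\<^sub>v y) = ?c + 2 * t * ?b + t\<^sup>2 * ?a"
      using assms symmetric_mat_scalar_prod_swap[OF sym assms(2-4)]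
      by (simp add: mult_add_distrib_mat_vec[of _ k k] scalar_prod_add_distrib[of _ k]
          add_scalar_prod_distrib[of _ k] mult_mat_vec[of _ k k] power2_eq_square algebra_simps)
    then show ?thesis using nonneg[of "x + t \<cdot>\<^sub>v y"] assms by simp
  qed
  show ?thesis
  proof (cases "?a = 0")
    case False
    then have a: "?a > 0" using nonneg[OF assms(4)] by simp
    have "?c - ?b\<^sup>2 / ?a \<ge> 0" using line[of "- ?b / ?a"] a
      by (simp add: power2_eq_square field_simps)
    then show ?thesis using a by (simp add: field_simps)
  next
    case True
    have "?b = 0"
    proof (rule ccontr)
      assume "?b \<noteq> 0"
      \<comment> \<open>the form is affine in \<open>t\<close> here, and this \<open>t\<close> gives it the value \<open>-1\<close>\<close>
      then show False using line[of "- (?c + 1) / (2 * ?b)"] True by (simp add: field_simps)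
    qed
    then show ?thesis using True by simp
  qed
qed

text \<open>Coercivity without compactness. A definite matrix has no kernel, hence \<open>det M \<noteq> 0\<close>, and each
  coordinate is a pairing in the inner product of \<open>M\<close>: \<open>det M * x\<^sub>i = y\<^sub>i \<bullet> M x\<close> where \<open>y\<^sub>i\<close> is the
  \<open>i\<close>-th column of the adjugate. Cauchy-Schwarz bounds the coordinate by the form.\<close>

lemma pos_def_lower_bound:
  assumes "pos_def M" "M \<in> carrier_mat k k"
  shows "\<exists>c>0. \<forall>x\<in>carrier_vec k. c * (x \<bullet> x) \<le> quad M x"
proof -
  have psd: "pos_semidef M" using pos_semidef_if_pos_def assms by auto
  have sym: "symmetric_mat M" using assms by (simp add: pos_def_def)
  have nonneg: "quad M v \<ge> 0" if "v \<in> carrier_vec k" for v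
    using psd assms that unfolding pos_semidef_def by auto
  have det: "det M \<noteq> 0"
  proof
    assume "det M = 0"
    then obtain v where v: "v \<in> carrier_vec k" "v \<noteq> 0\<^sub>v k" "M *\<^sub>v v = 0\<^sub>v k"
      using det_0_iff_vec_prod_zero[OF assms(2)] by auto
    then have "quad M v > 0" using assms by (auto simp: pos_def_def)
    then show False using v by simp
  qed
  define y where "y i = adj_mat M *\<^sub>v unit_vec k i" for i
  have adj: "adj_mat M \<in> carrier_mat k k" "M * adj_mat M = det M \<cdot>\<^sub>m 1\<^sub>m k"
    using adj_mat[OF assms(2)] by auto
  have y: "y i \<in> carrier_vec k" for i using adj by (simp add: y_def)
  have My: "M *\<^sub>v y i = det M \<cdot>\<^sub>v unit_vec k i" for i
  proof -
    have "M *\<^sub>v y i = (M * adj_mat M) *\<^sub>v unit_vec k i"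
      unfolding y_def using assms(2) adj(1) by (intro assoc_mult_mat_vec[symmetric]) auto
    also have "\<dots> = det M \<cdot>\<^sub>v unit_vec k i" unfolding adj(2)
      by (intro eq_vecI) auto
    finally show ?thesis .
  qed
  let ?C = "(\<Sum>i<k. quad M (y i)) + 1"
  have C: "?C > 0" using nonneg[OF y] by (smt (verit) sum_nonneg)
  have "(det M)\<^sup>2 / ?C * (x \<bullet> x) \<le> quad M x" if x: "x \<in> carrier_vec k" for x
  proof -
    have coord: "(det M * x $ i)\<^sup>2 \<le> quad M (y i) * quad M x" if "i < k" for i
    proof -
      have "y i \<bullet> (M *\<^sub>v x) = x \<bullet> (M *\<^sub>v y i)"
        by (rule symmetric_mat_scalar_prod_swap) (use sym assms x y in auto)
      also have "\<dots> = det M * x $ i" unfolding My using x that by simp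
      finally show ?thesis using pos_semidef_Cauchy_Schwarz[OF psd assms(2) x y] by metis
    qed
    have "(det M)\<^sup>2 * (x \<bullet> x) = (\<Sum>i<k. (det M * x $ i)\<^sup>2)"
      by (simp add: scalar_prod_self_sum[OF x] sum_distrib_left power_mult_distrib)
    also have "\<dots> \<le> (\<Sum>i<k. quad M (y i) * quad M x)" by (intro sum_mono coord) auto
    also have "\<dots> \<le> ?C * quad M x" using nonneg[OF x]
      by (simp add: sum_distrib_left sum_distrib_right algebra_simps)
    finally show ?thesis using C by (simp add: field_simps)
  qed
  moreover have "(det M)\<^sup>2 / ?C > 0" using det C by simp
  ultimately show ?thesis by blast
qed

lemma quad_upper_bound:
  assumes "M \<in> carrier_mat k k"
  shows "\<exists>c>0. \<forall>x\<in>carrier_vec k. quad M x \<le> c * (x \<bullet> x)"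
proof -
  let ?c = "(\<Sum>i<k. \<Sum>j<k. \<bar>M $$ (i, j)\<bar>) + 1"
  have "quad M x \<le> ?c * (x \<bullet> x)" if x: "x \<in> carrier_vec k" for x
  proof -
    have entry: "x $ i * (M $$ (i, j) * x $ j) \<le> \<bar>M $$ (i, j)\<bar> * (x \<bullet> x)" if "i < k" "j < k" for i j
    proof -
      have sq: "(x $ l)\<^sup>2 \<le> x \<bullet> x" if "l < k" for l
        unfolding scalar_prod_self_sum[OF x] using that by (intro member_le_sum) auto
      have "\<bar>x $ i * x $ j\<bar> \<le> x \<bullet> x"
        using sq[OF \<open>i < k\<close>] sq[OF \<open>j < k\<close>] sum_squares_bound[of "\<bar>x $ i\<bar>" "\<bar>x $ j\<bar>"]
        by (simp add: abs_mult)
      then have "\<bar>M $$ (i, j)\<bar> * \<bar>x $ i * x $ j\<bar> \<le> \<bar>M $$ (i, j)\<bar> * (x \<bullet> x)"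
        by (intro mult_left_mono) auto
      moreover have "x $ i * (M $$ (i, j) * x $ j) \<le> \<bar>M $$ (i, j)\<bar> * \<bar>x $ i * x $ j\<bar>"
        using abs_ge_self[of "x $ i * (M $$ (i, j) * x $ j)"] by (simp add: abs_mult mult_ac)
      ultimately show ?thesis by simp
    qed
    have "quad M x = (\<Sum>i<k. \<Sum>j<k. x $ i * (M $$ (i, j) * x $ j))"
      using x assms by (auto simp: scalar_prod_def lessThan_atLeast0 sum_distrib_left intro!: sum.cong)
    also have "\<dots> \<le> (\<Sum>i<k. \<Sum>j<k. \<bar>M $$ (i, j)\<bar> * (x \<bullet> x))" by (intro sum_mono entry) auto
    also have "\<dots> \<le> ?c * (x \<bullet> x)" using scalar_prod_self_nonneg[of x]
      by (simp add: sum_distrib_left sum_distrib_right algebra_simps)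
    finally show ?thesis .
  qed
  moreover have "?c > 0" by (smt (verit) sum_nonneg abs_ge_zero)
  ultimately show ?thesis by blast
qed

lemma mat_prec_quad_gap:
  assumes "A \<prec> B" "B \<in> carrier_mat k k"
  shows "\<exists>c>0. \<forall>x\<in>carrier_vec k. quad A x + c * (x \<bullet> x) \<le> quad B x"
proof -
  have A: "A \<in> carrier_mat k k" and pd: "pos_def (B - A)"
    using assms by (auto simp: mat_prec_def symmetric_mat_def)
  obtain c where c: "c > 0" "\<forall>x\<in>carrier_vec k. c * (x \<bullet> x) \<le> quad (B - A) x"
    using pos_def_lower_bound[OF pd minus_carrier_mat[OF A]] by auto
  then have "\<forall>x\<in>carrier_vec k. quad A x + c * (x \<bullet> x) \<le> quad B x"
    using quad_minus[OF assms(2) A] by (metis add.commute le_diff_eq)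
  then show ?thesis using c by blast
qed

section \<open>Dimensions\<close>

lemma n_hat_eq: "n_hat N = (in_dim N + n_phi N) + in_dim N"
  by (simp add: n_hat_def)

lemma weight_carrier:
  assumes "wf_network N" "i \<in> {1..depth N + 1}"
  shows "weight N i \<in> carrier_mat (width N i) (width N (i - 1))"
  using assms by (simp add: wf_network_def)

lemma N_vx_carrier:
  assumes "wf_network N"
  shows "N_vx N \<in> carrier_mat (n_phi N) (in_dim N)"
proof -
  have "weight N 1 \<in> carrier_mat (width N 1) (in_dim N)"
    using weight_carrier[OF assms, of 1] by (simp add: in_dim_def)
  then show ?thesis unfolding N_vx_def n_phi_def by (intro vcat_carrier) auto
qed

lemma N_vw_carrier:
  assumes "wf_network N"
  shows "N_vw N \<in> carrier_mat (n_phi N) (n_phi N)"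
  unfolding N_vw_def
proof (subst (2) n_phi_def, intro vcat_carrier ballI)
  fix i assume i: "i \<in> {1..depth N}"
  show "hcat (width N i) (\<lambda>j. if i = j + 1 then weight N i else 0\<^sub>m (width N i) (width N j)) (depth N)
    \<in> carrier_mat (width N i) (n_phi N)"
    unfolding n_phi_def using weight_carrier[OF assms, of i] i by (intro hcat_carrier) auto
qed

lemma N_uw_carrier:
  assumes "wf_network N"
  shows "N_uw N \<in> carrier_mat (out_dim N) (n_phi N)"
  unfolding N_uw_def n_phi_def
  using weight_carrier[OF assms, of "depth N + 1"] by (intro hcat_carrier) (auto simp: out_dim_def)

lemma w_phi_carrier:
  assumes "wf_network N" "x \<in> carrier_vec (in_dim N)"
  shows "w_phi N x \<in> carrier_vec (n_phi N)"
  unfolding w_phi_def n_phi_def using layer_out_carrier[OF assms] by (intro stack_carrier) auto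

lemma R_V_carrier: "wf_network N \<Longrightarrow> R_V N \<in> carrier_mat (in_dim N + out_dim N) (in_dim N + n_phi N)"
  unfolding R_V_def using N_uw_carrier by (auto simp: N_ux_def)

lemma R_phi_carrier: "wf_network N \<Longrightarrow> R_phi N \<in> carrier_mat (n_phi N + n_phi N) (in_dim N + n_phi N)"
  unfolding R_phi_def using N_vx_carrier by auto

lemma diag_of_vec_carrier: "d \<in> carrier_vec k \<Longrightarrow> diag_of_vec d \<in> carrier_mat k k"
  by (auto simp: diag_of_vec_def)

lemma Psi_phi_carrier:
  "\<beta> \<in> carrier_vec k \<Longrightarrow> Psi_phi k \<alpha> \<beta> \<in> carrier_mat (k + k) (k + k)"
  unfolding Psi_phi_def by (intro four_block_carrier_mat diag_of_vec_carrier) auto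

lemma M_phi_carrier: "M_phi k lam \<in> carrier_mat (k + k) (k + k)"
  unfolding M_phi_def by (intro four_block_carrier_mat) auto

lemma X_mat_carrier:
  assumes "wf_network N"
  shows "X_mat N \<alpha> \<beta> lam \<in> carrier_mat (in_dim N + n_phi N) (in_dim N + n_phi N)"
  unfolding X_mat_def
  using R_phi_carrier[OF assms] by auto

lemma A_0_carrier: "wf_plant S n m \<Longrightarrow> A_0 S \<in> carrier_mat n n"
  by (auto simp: A_0_def wf_plant_def)

lemma A_r_carrier: "wf_plant S n m \<Longrightarrow> A_r S \<in> carrier_mat n n"
  by (auto simp: A_r_def wf_plant_def)

lemma B_0_carrier: "B_0 N S \<in> carrier_mat (in_dim N) (n_phi N)"
  by (auto simp: B_0_def BN_lo_def BN_hi_def)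

lemma B_r_carrier: "B_r N S \<in> carrier_mat (in_dim N) (n_phi N)"
  by (auto simp: B_r_def BN_lo_def BN_hi_def)

lemma Z_mat_carrier:
  assumes "wf_network N" "wf_plant S (in_dim N) m" "P \<in> carrier_mat (in_dim N) (in_dim N)"
  shows "Z_mat N S \<alpha> \<beta> lam P \<in> carrier_mat (n_hat N) (n_hat N)"
proof -
  have "Z_mat N S \<alpha> \<beta> lam P \<in> carrier_mat ((in_dim N + n_phi N) + in_dim N) ((in_dim N + n_phi N) + in_dim N)"
    unfolding Z_mat_def Let_def
    using X_mat_carrier[OF assms(1)] assms(3) R_V_carrier[OF assms(1)] by auto
  then show ?thesis by (simp add: n_hat_eq add.assoc)
qed

lemma append_cols_index:
  assumes "A \<in> carrier_mat r c1" "B \<in> carrier_mat r c2" "i < r" "j < c1 + c2"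
  shows "(A @\<^sub>c B) $$ (i, j) = (if j < c1 then A $$ (i, j) else B $$ (i, j - c1))"
  unfolding append_cols_def using assms by auto

lemma D_mat_carrier:
  assumes "wf_plant S (in_dim N) m"
  shows "D_mat N S \<in> carrier_mat (n_hat N) (in_dim N)"
proof -
  have "A_r S @\<^sub>c B_r N S @\<^sub>c 0\<^sub>m (in_dim N) (in_dim N)
      \<in> carrier_mat (in_dim N) (in_dim N + (n_phi N + in_dim N))"
    by (intro append_cols_carrier A_r_carrier[OF assms] B_r_carrier) auto
  then show ?thesis unfolding D_mat_def by (simp add: n_hat_eq add.assoc)
qed

lemma U_mat_carrier:
  assumes "P \<in> carrier_mat (in_dim N) (in_dim N)"
  shows "U_mat N P \<in> carrier_mat (n_hat N) (n_hat N * in_dim N)"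
proof -
  have "0\<^sub>m (in_dim N + n_phi N) (in_dim N) @\<^sub>r P \<in> carrier_mat ((in_dim N + n_phi N) + in_dim N) (in_dim N)"
    using assms by (intro carrier_append_rows) auto
  then have "0\<^sub>m (in_dim N + n_phi N) (in_dim N) @\<^sub>r P \<in> carrier_mat (n_hat N) (in_dim N)"
    by (simp add: n_hat_eq add.assoc)
  then show ?thesis
    unfolding U_mat_def using hcat_carrier[of "n_hat N" _ "n_hat N" "\<lambda>_. in_dim N"] by simp
qed

section \<open>Eliminating the plant uncertainty\<close>

text \<open>The matrices \<open>Z\<close> and \<open>D\<close> know only the centre and the radius of the uncertainty. In
  \<open>\<zeta> = (x, y)\<close> the part \<open>x\<close> stands for the pair of a state and an activation deviation, and \<open>y\<close> for
  a candidate successor state. A deviation \<open>E\<close> from the centre enters the Lyapunov inequality only through the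
  bilinear term \<open>(P y) \<bullet> (E \<zeta>)\<close>, and the constant \<open>\<epsilon>\<close> here does not depend on \<open>E\<close>.\<close>

definition robustly_negative ::
    "network \<Rightarrow> plant \<Rightarrow> real mat \<Rightarrow> real mat \<Rightarrow> real \<Rightarrow> bool" where
  "robustly_negative N S Z P \<epsilon> \<longleftrightarrow>
     (\<forall>E\<in>carrier_mat (in_dim N) (n_hat N).
        (\<forall>i<n_hat N. \<forall>j<in_dim N. \<bar>E $$ (j, i)\<bar> \<le> D_mat N S $$ (i, j)) \<longrightarrow>
        (\<forall>x\<in>carrier_vec (in_dim N + n_phi N). \<forall>y\<in>carrier_vec (in_dim N).
           quad Z (x @\<^sub>v y) + 2 * ((P *\<^sub>v y) \<bullet> (E *\<^sub>v (x @\<^sub>v y)))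
             + \<epsilon> * ((x @\<^sub>v y) \<bullet> (x @\<^sub>v y)) \<le> 0))"

lemma sum_div_mod:
  fixes F :: "nat \<Rightarrow> nat \<Rightarrow> real"
  shows "(\<Sum>k<h * n. F (k div n) (k mod n)) = (\<Sum>i<h. \<Sum>j<n. F i j)"
proof -
  let ?f = "\<lambda>k. F (k div n) (k mod n)"
  have "sum ?f {i * n..<i * n + n} = (\<Sum>j<n. F i j)" for i
  proof -
    have "sum ?f {i * n..<i * n + n} = (\<Sum>j<n. ?f (j + i * n))"
      using sum.shift_bounds_nat_ivl[of ?f 0 "i * n" n] by (simp add: lessThan_atLeast0 add.commute)
    also have "\<dots> = (\<Sum>j<n. F i j)" by (intro sum.cong) auto
    finally show ?thesis .
  qed
  then show ?thesis using sum.nat_group[of ?f n h] by simp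
qed

lemma hcat_const_mult_vec:
  assumes C: "C \<in> carrier_mat r c"
  shows "hcat r (\<lambda>_. C) k *\<^sub>v vec (k * c) g = C *\<^sub>v vec c (\<lambda>j. \<Sum>i<k. g (i * c + j))"
proof (induction k)
  case 0
  have "vec c (\<lambda>j. \<Sum>i<0. g (i * c + j)) = 0\<^sub>v c" by (intro eq_vecI) auto
  then show ?case using C by (intro eq_vecI) (auto simp: scalar_prod_def)
next
  case (Suc k)
  have split: "vec (Suc k * c) g = vec (k * c) g @\<^sub>v vec c (\<lambda>j. g (k * c + j))"
    by (intro eq_vecI) (auto simp: algebra_simps)
  have "hcat r (\<lambda>_. C) k \<in> carrier_mat r (k * c)"
    using hcat_carrier[of k "\<lambda>_. C" r "\<lambda>_. c"] C by simp
  then have "hcat r (\<lambda>_. C) (Suc k) *\<^sub>v vec (Suc k * c) g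
      = C *\<^sub>v vec c (\<lambda>j. \<Sum>i<k. g (i * c + j)) + C *\<^sub>v vec c (\<lambda>j. g (k * c + j))"
    unfolding split hcat.simps Suc.IH[symmetric] using C by (intro append_cols_mult_vec) auto
  also have "\<dots> = C *\<^sub>v (vec c (\<lambda>j. \<Sum>i<k. g (i * c + j)) + vec c (\<lambda>j. g (k * c + j)))"
    using C by (intro mult_add_distrib_mat_vec[symmetric]) auto
  also have "vec c (\<lambda>j. \<Sum>i<k. g (i * c + j)) + vec c (\<lambda>j. g (k * c + j))
      = vec c (\<lambda>j. \<Sum>i<Suc k. g (i * c + j))" by (intro eq_vecI) auto
  finally show ?case .
qed

lemma Gam_mat_eq_diag:
  "Gam_mat N S \<gamma> = mat_diag (n_hat N) (\<lambda>i. \<Sum>j<in_dim N. \<gamma> i j * (D_mat N S $$ (i, j))\<^sup>2)"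
proof (intro eq_matI)
  fix r c assume rc: "r < dim_row (mat_diag (n_hat N) (\<lambda>i. \<Sum>j<in_dim N. \<gamma> i j * (D_mat N S $$ (i, j))\<^sup>2))"
    "c < dim_col (mat_diag (n_hat N) (\<lambda>i. \<Sum>j<in_dim N. \<gamma> i j * (D_mat N S $$ (i, j))\<^sup>2))"
  then have rc: "r < n_hat N" "c < n_hat N" by (auto simp: mat_diag_def)
  let ?s = "\<lambda>i. \<Sum>j<in_dim N. \<gamma> i j * (D_mat N S $$ (i, j))\<^sup>2"
  have "Gam_mat N S \<gamma> $$ (r, c) =
      (\<Sum>i<n_hat N. \<Sum>j<in_dim N. \<gamma> i j * (D_mat N S $$ (i, j))\<^sup>2 *
        (unit_vec (n_hat N) i $ r * unit_vec (n_hat N) i $ c))"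
    using rc by (simp add: Gam_mat_def)
  also have "\<dots> = (\<Sum>i<n_hat N. if i = r then if r = c then ?s r else 0 else 0)"
    using rc by (intro sum.cong) (auto simp: sum_distrib_right)
  also have "\<dots> = (if r = c then ?s r else 0)" using rc by (simp add: sum.delta)
  finally show "Gam_mat N S \<gamma> $$ (r, c) = mat_diag (n_hat N) ?s $$ (r, c)"
    using rc by (simp add: mat_diag_def)
qed (auto simp: Gam_mat_def mat_diag_def)

text \<open>The vector \<open>\<eta>\<close> collects the contributions \<open>E\<^sub>j\<^sub>i \<zeta>\<^sub>i\<close> of the single entries of \<open>E\<close>; its blocks
  add up to \<open>E \<zeta>\<close>.\<close>

definition entry_contributions :: "network \<Rightarrow> real mat \<Rightarrow> real vec \<Rightarrow> real vec" where
  "entry_contributions N E z =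
     vec (n_hat N * in_dim N) (\<lambda>k. E $$ (k mod in_dim N, k div in_dim N) * z $ (k div in_dim N))"

lemma U_mat_entry_contributions:
  assumes P: "P \<in> carrier_mat (in_dim N) (in_dim N)" "symmetric_mat P"
    and E: "E \<in> carrier_mat (in_dim N) (n_hat N)"
    and x: "x \<in> carrier_vec (in_dim N + n_phi N)" and y: "y \<in> carrier_vec (in_dim N)"
  shows "(x @\<^sub>v y) \<bullet> (U_mat N P *\<^sub>v entry_contributions N E (x @\<^sub>v y)) = (P *\<^sub>v y) \<bullet> (E *\<^sub>v (x @\<^sub>v y))"
proof -
  let ?n = "in_dim N" and ?h = "n_hat N" and ?z = "x @\<^sub>v y"
  let ?C = "0\<^sub>m (?n + n_phi N) ?n @\<^sub>r P"
  note h = n_hat_eq[of N]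
  have z: "?z \<in> carrier_vec ?h" unfolding h using x y by auto
  have C: "?C \<in> carrier_mat ?h ?n" unfolding h using P by (intro carrier_append_rows) auto
  have Ez: "E *\<^sub>v ?z \<in> carrier_vec ?n" using E z by auto
  have "vec ?n (\<lambda>j. \<Sum>i<?h. E $$ ((i * ?n + j) mod ?n, (i * ?n + j) div ?n) * ?z $ ((i * ?n + j) div ?n))
      = E *\<^sub>v ?z"
    using E z by (intro eq_vecI) (auto simp: scalar_prod_def lessThan_atLeast0 simp del: index_append_vec intro!: sum.cong)
  then have "U_mat N P *\<^sub>v entry_contributions N E ?z = ?C *\<^sub>v (E *\<^sub>v ?z)"
    unfolding U_mat_def entry_contributions_def using hcat_const_mult_vec[OF C] by simp
  also have "\<dots> = 0\<^sub>m (?n + n_phi N) ?n *\<^sub>v (E *\<^sub>v ?z) @\<^sub>v P *\<^sub>v (E *\<^sub>v ?z)"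
    by (rule mat_mult_append[of _ "?n + n_phi N" ?n _ ?n]) (use P Ez in auto)
  also have "0\<^sub>m (?n + n_phi N) ?n *\<^sub>v (E *\<^sub>v ?z) = 0\<^sub>v (?n + n_phi N)" using Ez by auto
  also have "?z \<bullet> (0\<^sub>v (?n + n_phi N) @\<^sub>v P *\<^sub>v (E *\<^sub>v ?z)) = x \<bullet> 0\<^sub>v (?n + n_phi N) + y \<bullet> (P *\<^sub>v (E *\<^sub>v ?z))"
    using x y P Ez by (intro scalar_prod_append) auto
  also have "\<dots> = (E *\<^sub>v ?z) \<bullet> (P *\<^sub>v y)"
    using x symmetric_mat_scalar_prod_swap[OF P(2,1) y Ez] by simp
  also have "\<dots> = (P *\<^sub>v y) \<bullet> (E *\<^sub>v ?z)" using P y Ez by (intro comm_scalar_prod) auto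
  finally show ?thesis .
qed

text \<open>Entrywise, \<open>\<gamma> (D\<^sup>2 \<zeta>\<^sub>i\<^sup>2 - \<eta>\<^sup>2) \<ge> 0\<close> for \<open>\<eta> = E\<^sub>j\<^sub>i \<zeta>\<^sub>i\<close>: the two multiplier terms pay for each other.\<close>

lemma V_mat_entry_contributions_le:
  assumes E: "E \<in> carrier_mat (in_dim N) (n_hat N)"
    "\<forall>i<n_hat N. \<forall>j<in_dim N. \<bar>E $$ (j, i)\<bar> \<le> D_mat N S $$ (i, j)"
    and pos: "\<forall>i<n_hat N. \<forall>j<in_dim N. \<gamma> i j > 0" and z: "z \<in> carrier_vec (n_hat N)"
  shows "quad (V_mat N \<gamma>) (entry_contributions N E z) \<le> quad (Gam_mat N S \<gamma>) z"
proof -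
  let ?n = "in_dim N" and ?h = "n_hat N"
  have e: "entry_contributions N E z \<in> carrier_vec (?h * ?n)" by (simp add: entry_contributions_def)
  have "quad (V_mat N \<gamma>) (entry_contributions N E z)
      = (\<Sum>k<?h * ?n. \<gamma> (k div ?n) (k mod ?n) * (E $$ (k mod ?n, k div ?n) * z $ (k div ?n))\<^sup>2)"
    unfolding V_mat_def quad_mat_diag[OF e] by (simp add: entry_contributions_def)
  also have "\<dots> = (\<Sum>i<?h. \<Sum>j<?n. \<gamma> i j * (E $$ (j, i) * z $ i)\<^sup>2)"
    by (rule sum_div_mod[of "\<lambda>i j. \<gamma> i j * (E $$ (j, i) * z $ i)\<^sup>2"])
  also have "\<dots> \<le> (\<Sum>i<?h. \<Sum>j<?n. \<gamma> i j * (D_mat N S $$ (i, j))\<^sup>2 * (z $ i)\<^sup>2)"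
  proof (intro sum_mono)
    fix i j assume ij: "i \<in> {..<?h}" "j \<in> {..<?n}"
    have "(E $$ (j, i))\<^sup>2 \<le> (D_mat N S $$ (i, j))\<^sup>2"
      using E(2) ij by (metis abs_ge_zero lessThan_iff power2_abs power_mono)
    then have "\<gamma> i j * ((E $$ (j, i))\<^sup>2 * (z $ i)\<^sup>2) \<le> \<gamma> i j * ((D_mat N S $$ (i, j))\<^sup>2 * (z $ i)\<^sup>2)"
      using pos ij by (intro mult_left_mono mult_right_mono) (auto intro: less_imp_le)
    then show "\<gamma> i j * (E $$ (j, i) * z $ i)\<^sup>2 \<le> \<gamma> i j * (D_mat N S $$ (i, j))\<^sup>2 * (z $ i)\<^sup>2"
      by (simp add: power_mult_distrib mult.assoc)
  qed
  also have "\<dots> = quad (Gam_mat N S \<gamma>) z"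
    unfolding Gam_mat_eq_diag quad_mat_diag[OF z] by (simp add: sum_distrib_right)
  finally show ?thesis .
qed

lemma zero_mat_mult_vec: "x \<in> carrier_vec c \<Longrightarrow> 0\<^sub>m r c *\<^sub>v x = (0\<^sub>v r :: real vec)"
  by (intro eq_vecI) (auto simp: scalar_prod_def)

lemma mat_mult_zero_vec: "A \<in> carrier_mat r c \<Longrightarrow> A *\<^sub>v 0\<^sub>v c = (0\<^sub>v r :: real vec)"
  by (intro eq_vecI) (auto simp: scalar_prod_def)

lemma quad_zero: "x \<in> carrier_vec k \<Longrightarrow> quad (0\<^sub>m k k) x = 0"
  by (simp add: zero_mat_mult_vec)

lemma V_mat_carrier: "V_mat N \<gamma> \<in> carrier_mat (n_hat N * in_dim N) (n_hat N * in_dim N)"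
  by (auto simp: V_mat_def)

lemma Gam_mat_carrier: "Gam_mat N S \<gamma> \<in> carrier_mat (n_hat N) (n_hat N)"
  by (auto simp: Gam_mat_def)

lemma entry_contributions_carrier:
  "entry_contributions N E z \<in> carrier_vec (n_hat N * in_dim N)"
  by (simp add: entry_contributions_def)

text \<open>At the entry contributions, the block \<open>U\<close> reproduces exactly the uncertain term of the Lyapunov inequality.\<close>

lemma quad_U_block_entry_contributions:
  assumes P: "P \<in> carrier_mat (in_dim N) (in_dim N)" "symmetric_mat P"
    and E: "E \<in> carrier_mat (in_dim N) (n_hat N)"
    and x: "x \<in> carrier_vec (in_dim N + n_phi N)" and y: "y \<in> carrier_vec (in_dim N)"
    and A: "A \<in> carrier_mat (n_hat N) (n_hat N)"
    and W: "W \<in> carrier_mat (n_hat N * in_dim N) (n_hat N * in_dim N)"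
  defines "\<eta> \<equiv> entry_contributions N E (x @\<^sub>v y)"
  shows "quad (four_block_mat A (U_mat N P) (transpose_mat (U_mat N P)) W) ((x @\<^sub>v y) @\<^sub>v \<eta>)
    = quad A (x @\<^sub>v y) + 2 * ((P *\<^sub>v y) \<bullet> (E *\<^sub>v (x @\<^sub>v y))) + quad W \<eta>"
proof -
  have z: "x @\<^sub>v y \<in> carrier_vec (n_hat N)" unfolding n_hat_eq using x y by auto
  have \<eta>: "\<eta> \<in> carrier_vec (n_hat N * in_dim N)" by (simp add: \<eta>_def entry_contributions_carrier)
  note U = U_mat_carrier[OF P(1)]
  have "\<eta> \<bullet> (transpose_mat (U_mat N P) *\<^sub>v (x @\<^sub>v y)) = (P *\<^sub>v y) \<bullet> (E *\<^sub>v (x @\<^sub>v y))"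
    using scalar_prod_transpose_mult_vec[OF U \<eta> z] U_mat_entry_contributions[OF P E x y]
    by (simp add: \<eta>_def)
  then show ?thesis
    using quad_four_block_sym[OF A _ W z \<eta>, of "transpose_mat (U_mat N P)"] U by simp
qed

lemma robustly_negative_if_LMI_I:
  assumes Z: "Z \<in> carrier_mat (n_hat N) (n_hat N)"
    and P: "P \<in> carrier_mat (in_dim N) (in_dim N)" "symmetric_mat P"
    and pos: "\<forall>i<n_hat N. \<forall>j<in_dim N. \<gamma> i j > 0"
    and lmi: "four_block_mat (Z + Gam_mat N S \<gamma>) (U_mat N P) (transpose_mat (U_mat N P)) (- V_mat N \<gamma>)
      \<prec> 0\<^sub>m (n_hat N + n_hat N * in_dim N) (n_hat N + n_hat N * in_dim N)" (is "?M \<prec> 0\<^sub>m ?k ?k")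
  shows "\<exists>\<epsilon>>0. robustly_negative N S Z P \<epsilon>"
proof -
  obtain c where c: "c > 0" "\<And>v. v \<in> carrier_vec ?k \<Longrightarrow> quad ?M v + c * (v \<bullet> v) \<le> quad (0\<^sub>m ?k ?k) v"
    using mat_prec_quad_gap[OF lmi zero_carrier_mat] by auto
  have "robustly_negative N S Z P c"
    unfolding robustly_negative_def
  proof (intro ballI impI)
    fix E and x y :: "real vec"
    assume E: "E \<in> carrier_mat (in_dim N) (n_hat N)"
      "\<forall>i<n_hat N. \<forall>j<in_dim N. \<bar>E $$ (j, i)\<bar> \<le> D_mat N S $$ (i, j)"
      and x: "x \<in> carrier_vec (in_dim N + n_phi N)" and y: "y \<in> carrier_vec (in_dim N)"
    let ?z = "x @\<^sub>v y"
    let ?\<eta> = "entry_contributions N E ?z"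
    have z: "?z \<in> carrier_vec (n_hat N)" unfolding n_hat_eq using x y by auto
    have \<eta>: "?\<eta> \<in> carrier_vec (n_hat N * in_dim N)" by (rule entry_contributions_carrier)
    have v: "?z @\<^sub>v ?\<eta> \<in> carrier_vec ?k" using z \<eta> by auto
    have A: "Z + Gam_mat N S \<gamma> \<in> carrier_mat (n_hat N) (n_hat N)" using Gam_mat_carrier by auto
    have W: "- V_mat N \<gamma> \<in> carrier_mat (n_hat N * in_dim N) (n_hat N * in_dim N)"
      using V_mat_carrier by auto
    have "quad ?M (?z @\<^sub>v ?\<eta>) + c * ((?z @\<^sub>v ?\<eta>) \<bullet> (?z @\<^sub>v ?\<eta>)) \<le> 0"
      using c(2)[OF v] quad_zero[OF v] by simp
    moreover have "(?z @\<^sub>v ?\<eta>) \<bullet> (?z @\<^sub>v ?\<eta>) = ?z \<bullet> ?z + ?\<eta> \<bullet> ?\<eta>"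
      by (rule scalar_prod_append[OF z \<eta> z \<eta>])
    moreover have "c * (?z \<bullet> ?z + ?\<eta> \<bullet> ?\<eta>) \<ge> c * (?z \<bullet> ?z)"
      using c(1) scalar_prod_self_nonneg[of ?\<eta>] by simp
    moreover note quad_U_block_entry_contributions[OF P E(1) x y A W]
      quad_add[OF Z Gam_mat_carrier z] quad_uminus[OF V_mat_carrier \<eta>]
      V_mat_entry_contributions_le[OF E pos z]
    ultimately show "quad Z ?z + 2 * ((P *\<^sub>v y) \<bullet> (E *\<^sub>v ?z)) + c * (?z \<bullet> ?z) \<le> 0"
      by (smt (verit))
  qed
  with c(1) show ?thesis by blast
qed

text \<open>Compared with (LMI-I) the diagonal blocks change sign but \<open>U\<close> does not, so the test vector is
  built from \<open>- E\<close>. The slack \<open>\<epsilon>\<close> comes from \<open>Y \<prec> - Z\<close>.\<close>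

lemma robustly_negative_if_LMI_III:
  assumes Z: "Z \<in> carrier_mat (n_hat N) (n_hat N)"
    and P: "P \<in> carrier_mat (in_dim N) (in_dim N)" "symmetric_mat P"
    and pos: "\<forall>i<n_hat N. \<forall>j<in_dim N. \<gamma> i j > 0"
    and Y: "Y \<in> carrier_mat (n_hat N) (n_hat N)" "Y \<prec> - Z"
    and lmi: "0\<^sub>m (n_hat N + n_hat N * in_dim N) (n_hat N + n_hat N * in_dim N) \<prec>
      four_block_mat (Y - Gam_mat N S \<gamma>) (U_mat N P) (transpose_mat (U_mat N P)) (V_mat N \<gamma>)"
      (is "0\<^sub>m ?k ?k \<prec> ?M")
  shows "\<exists>\<epsilon>>0. robustly_negative N S Z P \<epsilon>"
proof -
  have A: "Y - Gam_mat N S \<gamma> \<in> carrier_mat (n_hat N) (n_hat N)"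
    by (rule minus_carrier_mat[OF Gam_mat_carrier])
  have M: "?M \<in> carrier_mat ?k ?k"
    by (rule four_block_carrier_mat[OF A V_mat_carrier])
  obtain c where c: "c > 0" "\<And>v. v \<in> carrier_vec (n_hat N) \<Longrightarrow> quad Y v + c * (v \<bullet> v) \<le> quad (- Z) v"
    using mat_prec_quad_gap[OF Y(2) uminus_carrier_mat[OF Z]] by auto
  obtain d where d: "d > 0" "\<And>v. v \<in> carrier_vec ?k \<Longrightarrow> quad (0\<^sub>m ?k ?k) v + d * (v \<bullet> v) \<le> quad ?M v"
    using mat_prec_quad_gap[OF lmi M] by auto
  have "robustly_negative N S Z P c"
    unfolding robustly_negative_def
  proof (intro ballI impI)
    fix E and x y :: "real vec"
    assume E: "E \<in> carrier_mat (in_dim N) (n_hat N)"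
      "\<forall>i<n_hat N. \<forall>j<in_dim N. \<bar>E $$ (j, i)\<bar> \<le> D_mat N S $$ (i, j)"
      and x: "x \<in> carrier_vec (in_dim N + n_phi N)" and y: "y \<in> carrier_vec (in_dim N)"
    let ?z = "x @\<^sub>v y"
    let ?\<eta> = "entry_contributions N (- E) ?z"
    have E': "- E \<in> carrier_mat (in_dim N) (n_hat N)"
      "\<forall>i<n_hat N. \<forall>j<in_dim N. \<bar>(- E) $$ (j, i)\<bar> \<le> D_mat N S $$ (i, j)" using E by auto
    have z: "?z \<in> carrier_vec (n_hat N)" unfolding n_hat_eq using x y by auto
    have \<eta>: "?\<eta> \<in> carrier_vec (n_hat N * in_dim N)" by (rule entry_contributions_carrier)
    have v: "?z @\<^sub>v ?\<eta> \<in> carrier_vec ?k" using z \<eta> by auto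
    have "0 \<le> d * ((?z @\<^sub>v ?\<eta>) \<bullet> (?z @\<^sub>v ?\<eta>))"
      using d(1) scalar_prod_self_nonneg by simp
    then have "0 \<le> quad ?M (?z @\<^sub>v ?\<eta>)"
      using d(2)[OF v] quad_zero[OF v] by simp
    moreover have "(P *\<^sub>v y) \<bullet> (- E *\<^sub>v ?z) = - ((P *\<^sub>v y) \<bullet> (E *\<^sub>v ?z))"
    proof -
      have "- E *\<^sub>v ?z = - (E *\<^sub>v ?z)" using carrier_vecD[OF z] carrier_matD[OF E(1)] by (intro uminus_mult_mat_vec) simp
      then show ?thesis using E(1) P(1) by simp
    qed
    moreover note quad_U_block_entry_contributions[OF P E'(1) x y A V_mat_carrier]
      quad_minus[OF Y(1) Gam_mat_carrier z] quad_uminus[OF Z z]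
      V_mat_entry_contributions_le[OF E' pos z] c(2)[OF z]
    ultimately show "quad Z ?z + 2 * ((P *\<^sub>v y) \<bullet> (E *\<^sub>v ?z)) + c * (?z \<bullet> ?z) \<le> 0"
      by (smt (verit))
  qed
  with c(1) show ?thesis by blast
qed

lemma quad_diagonal_mat:
  assumes "diagonal_mat M" "M \<in> carrier_mat k k" "x \<in> carrier_vec k"
  shows "quad M x = (\<Sum>i<k. M $$ (i, i) * (x $ i)\<^sup>2)"
proof -
  have "M = mat_diag k (\<lambda>i. M $$ (i, i))"
    using assms by (intro eq_matI) (auto simp: diagonal_mat_def mat_diag_def)
  then show ?thesis using quad_mat_diag[OF assms(3)] by metis
qed

text \<open>With \<open>\<bar>\<zeta>\<bar>\<close> the entrywise absolute value, \<open>\<bar>E \<zeta>\<bar> \<le> D\<^sup>T \<bar>\<zeta>\<bar>\<close>, and diagonal forms see only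
  absolute values. Hence the nonnegative diagonal form \<open>Q\<close> at \<open>E \<zeta>\<close> is at most the form of
  \<open>D Q D\<^sup>T\<close> at \<open>\<bar>\<zeta>\<bar>\<close>, so at most that of \<open>T\<close> at \<open>\<bar>\<zeta>\<bar>\<close>, which is that of \<open>T\<close> at \<open>\<zeta>\<close>.\<close>

lemma diagonal_multiplier_bound:
  fixes D :: "real mat"
  assumes D: "D \<in> carrier_mat h n" and E: "E \<in> carrier_mat n h"
    "\<forall>i<h. \<forall>j<n. \<bar>E $$ (j, i)\<bar> \<le> D $$ (i, j)"
    and T: "T \<in> carrier_mat h h" "diagonal_mat T"
    and Q: "Q \<in> carrier_mat n n" "diagonal_mat Q" "\<forall>j<n. Q $$ (j, j) \<ge> 0"
    and prec: "D * Q * transpose_mat D \<prec> T" and z: "z \<in> carrier_vec h"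
  shows "quad Q (E *\<^sub>v z) \<le> quad T z"
proof -
  define a where "a = map_vec abs z"
  have a: "a \<in> carrier_vec h" using z by (simp add: a_def)
  have Ez: "E *\<^sub>v z \<in> carrier_vec n" using E z by auto
  have Da: "transpose_mat D *\<^sub>v a \<in> carrier_vec n" using D a by auto
  have entry: "\<bar>(E *\<^sub>v z) $ j\<bar> \<le> (transpose_mat D *\<^sub>v a) $ j" if j: "j < n" for j
  proof -
    have "(E *\<^sub>v z) $ j = (\<Sum>i<h. E $$ (j, i) * z $ i)"
      using j E z by (auto simp: scalar_prod_def lessThan_atLeast0)
    then have "\<bar>(E *\<^sub>v z) $ j\<bar> \<le> (\<Sum>i<h. \<bar>E $$ (j, i) * z $ i\<bar>)" by (simp add: sum_abs)
    also have "\<dots> \<le> (\<Sum>i<h. D $$ (i, j) * a $ i)"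
      using E(2) j z by (intro sum_mono) (auto simp: a_def abs_mult intro!: mult_right_mono)
    also have "\<dots> = (transpose_mat D *\<^sub>v a) $ j"
      using j D a by (auto simp: scalar_prod_def lessThan_atLeast0)
    finally show ?thesis .
  qed
  have "quad Q (E *\<^sub>v z) = (\<Sum>j<n. Q $$ (j, j) * ((E *\<^sub>v z) $ j)\<^sup>2)"
    by (rule quad_diagonal_mat) (use Q Ez in auto)
  also have "\<dots> \<le> (\<Sum>j<n. Q $$ (j, j) * ((transpose_mat D *\<^sub>v a) $ j)\<^sup>2)"
    using Q(3) power_mono[OF entry abs_ge_zero, of _ 2] by (intro sum_mono mult_left_mono) auto
  also have "\<dots> = quad Q (transpose_mat D *\<^sub>v a)"
    by (rule quad_diagonal_mat[symmetric]) (use Q Da in auto)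
  also have "\<dots> = a \<bullet> (D *\<^sub>v (Q *\<^sub>v (transpose_mat D *\<^sub>v a)))"
    by (rule transpose_vec_mult_scalar) (use Q D Da a in auto)
  also have "\<dots> = quad (D * Q * transpose_mat D) a"
    using assoc_mult_mat_vec[of "D * Q" h n "transpose_mat D" h a] assoc_mult_mat_vec[OF D Q(1) Da]
      D Q a by simp
  also have "\<dots> \<le> quad T a"
  proof -
    obtain c where c: "c > 0" "\<forall>x\<in>carrier_vec h. quad (D * Q * transpose_mat D) x + c * (x \<bullet> x) \<le> quad T x"
      using mat_prec_quad_gap[OF prec T(1)] by blast
    have "c * (a \<bullet> a) \<ge> 0" using c(1) scalar_prod_self_nonneg[of a] by simp
    then show ?thesis using c(2) a by (smt (verit))
  qed
  also have "\<dots> = quad T z"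
    using quad_diagonal_mat[OF T(2,1) a] quad_diagonal_mat[OF T(2,1) z] z by (simp add: a_def)
  finally show ?thesis .
qed

lemma robustly_negative_if_LMI_II:
  fixes N :: network and P :: "real mat"
  defines "L \<equiv> 0\<^sub>m (in_dim N) (in_dim N + n_phi N) @\<^sub>c P"
  assumes plant: "wf_plant S (in_dim N) m"
    and Z: "Z \<in> carrier_mat (n_hat N) (n_hat N)"
    and P: "P \<in> carrier_mat (in_dim N) (in_dim N)"
    and T: "T \<in> carrier_mat (n_hat N) (n_hat N)" "diagonal_mat T"
    and Q: "Q \<in> carrier_mat (in_dim N) (in_dim N)" "diagonal_mat Q"
    and prec: "D_mat N S * Q * transpose_mat (D_mat N S) \<prec> T"
    and lmi: "four_block_mat (Z + T) (transpose_mat L) L (- Q)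
      \<prec> 0\<^sub>m (n_hat N + in_dim N) (n_hat N + in_dim N)" (is "?M \<prec> 0\<^sub>m ?k ?k")
  shows "\<exists>\<epsilon>>0. robustly_negative N S Z P \<epsilon>"
proof -
  let ?n = "in_dim N"
  obtain c where c: "c > 0" "\<And>v. v \<in> carrier_vec ?k \<Longrightarrow> quad ?M v + c * (v \<bullet> v) \<le> quad (0\<^sub>m ?k ?k) v"
    using mat_prec_quad_gap[OF lmi zero_carrier_mat] by auto
  have L: "L \<in> carrier_mat ?n (n_hat N)"
    unfolding L_def n_hat_eq by (rule append_cols_carrier) (use P in auto)
  have A: "Z + T \<in> carrier_mat (n_hat N) (n_hat N)" using T(1) by simp
  have nQ: "- Q \<in> carrier_mat ?n ?n" using Q(1) by simp
  have block: "quad Z z + quad T z + 2 * (e \<bullet> (L *\<^sub>v z)) - quad Q e + c * (z \<bullet> z + e \<bullet> e) \<le> 0"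
    if z: "z \<in> carrier_vec (n_hat N)" and e: "e \<in> carrier_vec ?n" for z e
  proof -
    have v: "z @\<^sub>v e \<in> carrier_vec ?k" using z e by auto
    have "(z @\<^sub>v e) \<bullet> (z @\<^sub>v e) = z \<bullet> z + e \<bullet> e" by (rule scalar_prod_append[OF z e z e])
    then show ?thesis
      using c(2)[OF v] quad_zero[OF v] quad_four_block_sym[OF A L nQ z e]
        quad_add[OF Z T(1) z] quad_uminus[OF Q(1) e] by simp
  qed
  \<comment> \<open>the lower right block of the inequality forces \<open>Q\<close> to be nonnegative\<close>
  have Q_pos: "Q $$ (j, j) \<ge> 0" if j: "j < ?n" for j
  proof -
    have "quad Q (unit_vec ?n j) = Q $$ (j, j)"
      unfolding quad_diagonal_mat[OF Q(2,1) unit_vec_carrier] using j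
      by (subst sum.remove[of _ j]) auto
    moreover have "quad Q (unit_vec ?n j) \<ge> c * (unit_vec ?n j \<bullet> unit_vec ?n j)"
      using block[of "0\<^sub>v (n_hat N)" "unit_vec ?n j"] Z T L j by simp
    moreover have "c * (unit_vec ?n j \<bullet> unit_vec ?n j) \<ge> 0"
      using c(1) scalar_prod_self_nonneg[of "unit_vec ?n j"] by simp
    ultimately show ?thesis by simp
  qed
  have "robustly_negative N S Z P c"
    unfolding robustly_negative_def
  proof (intro ballI impI)
    fix E and x y :: "real vec"
    assume E: "E \<in> carrier_mat ?n (n_hat N)"
      "\<forall>i<n_hat N. \<forall>j<in_dim N. \<bar>E $$ (j, i)\<bar> \<le> D_mat N S $$ (i, j)"
      and x: "x \<in> carrier_vec (?n + n_phi N)" and y: "y \<in> carrier_vec ?n"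
    let ?z = "x @\<^sub>v y"
    have z: "?z \<in> carrier_vec (n_hat N)" unfolding n_hat_eq using x y by auto
    have Ez: "E *\<^sub>v ?z \<in> carrier_vec ?n" using E z by auto
    have "L *\<^sub>v ?z = 0\<^sub>m ?n (?n + n_phi N) *\<^sub>v x + P *\<^sub>v y"
      unfolding L_def by (rule append_cols_mult_vec) (use P x y in auto)
    also have "\<dots> = P *\<^sub>v y" using x P y by (simp add: zero_mat_mult_vec)
    finally have "(E *\<^sub>v ?z) \<bullet> (L *\<^sub>v ?z) = (P *\<^sub>v y) \<bullet> (E *\<^sub>v ?z)"
      using P y Ez by (simp add: comm_scalar_prod[of _ ?n])
    moreover have "quad Q (E *\<^sub>v ?z) \<le> quad T ?z"
      by (rule diagonal_multiplier_bound[OF D_mat_carrier[OF plant] E T Q _ prec z]) (use Q_pos in auto)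
    moreover have "c * (?z \<bullet> ?z) \<le> c * (?z \<bullet> ?z + (E *\<^sub>v ?z) \<bullet> (E *\<^sub>v ?z))"
      using c(1) scalar_prod_self_nonneg[of "E *\<^sub>v ?z"] by simp
    ultimately show "quad Z ?z + 2 * ((P *\<^sub>v y) \<bullet> (E *\<^sub>v ?z)) + c * (?z \<bullet> ?z) \<le> 0"
      using block[OF z Ez] by simp
  qed
  with c(1) show ?thesis by blast
qed

lemma feasible_robustly_negative:
  assumes net: "wf_network N" and plant: "wf_plant S (in_dim N) m"
    and feasible: "LMI_I N S vhi1 \<alpha> \<beta> P \<or> LMI_II N S vhi1 \<alpha> \<beta> P \<or> LMI_III N S vhi1 \<alpha> \<beta> P"
  shows "\<exists>lam \<epsilon>. LMI_base N vhi1 P lam \<and> \<epsilon> > 0 \<and> robustly_negative N S (Z_mat N S \<alpha> \<beta> lam P) P \<epsilon>"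
proof -
  have base: "P \<in> carrier_mat (in_dim N) (in_dim N)" "symmetric_mat P"
    "Z_mat N S \<alpha> \<beta> lam P \<in> carrier_mat (n_hat N) (n_hat N)" if "LMI_base N vhi1 P lam" for lam
    using that Z_mat_carrier[OF net plant] by (auto simp: LMI_base_def pos_def_def)
  from feasible show ?thesis
  proof (elim disjE)
    assume "LMI_I N S vhi1 \<alpha> \<beta> P"
    then show ?thesis
      unfolding LMI_I_def Let_def using robustly_negative_if_LMI_I[OF base(3,1,2)] by blast
  next
    assume "LMI_II N S vhi1 \<alpha> \<beta> P"
    then show ?thesis
      unfolding LMI_II_def Let_def using robustly_negative_if_LMI_II[OF plant base(3,1)] by blast
  next
    assume "LMI_III N S vhi1 \<alpha> \<beta> P"
    then show ?thesis
      unfolding LMI_III_def Let_def using robustly_negative_if_LMI_III[OF base(3,1,2)] by blast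
  qed
qed

section \<open>The Lyapunov inequality along the closed loop\<close>

text \<open>\<open>\<Psi>\<^sub>\<phi> R\<^sub>\<phi>\<close> maps \<open>(x, w)\<close> to the two sector residuals \<open>\<beta> v - w\<close> and \<open>w - \<alpha> v\<close>, and
  \<open>M\<^sub>\<phi>(\<lambda>)\<close> pairs them with weights \<open>\<lambda>\<close>.\<close>

lemma quad_X_mat:
  assumes net: "wf_network N" and \<alpha>: "\<alpha> \<in> carrier_vec (n_phi N)" and \<beta>: "\<beta> \<in> carrier_vec (n_phi N)"
    and lam: "lam \<in> carrier_vec (n_phi N)"
    and x: "x \<in> carrier_vec (in_dim N)" and w: "w \<in> carrier_vec (n_phi N)"
  defines "v \<equiv> N_vx N *\<^sub>v x + N_vw N *\<^sub>v w"
  shows "quad (X_mat N \<alpha> \<beta> lam) (x @\<^sub>v w)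
    = 2 * (\<Sum>k<n_phi N. lam $ k * ((\<beta> $ k * v $ k - w $ k) * (w $ k - \<alpha> $ k * v $ k)))"
proof -
  let ?p = "n_phi N" and ?R = "R_phi N" and ?Psi = "Psi_phi (n_phi N) \<alpha> \<beta>" and ?M = "M_phi (n_phi N) lam"
  let ?z = "x @\<^sub>v w"
  have v: "v \<in> carrier_vec ?p" unfolding v_def using N_vx_carrier[OF net] N_vw_carrier[OF net] x w by auto
  have z: "?z \<in> carrier_vec (in_dim N + ?p)" using x w by auto
  note R = R_phi_carrier[OF net] and Psi = Psi_phi_carrier[OF \<beta>, of \<alpha>] and M = M_phi_carrier[of ?p lam]
  have Rz: "?R *\<^sub>v ?z = v @\<^sub>v w"
    unfolding R_phi_def v_def
    by (subst four_block_mat_mult_vec[OF N_vx_carrier[OF net] N_vw_carrier[OF net] _ _ x w])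
      (use x w in \<open>auto simp: zero_mat_mult_vec\<close>)
  define a where "a = vec ?p (\<lambda>k. \<beta> $ k * v $ k - w $ k)"
  define b where "b = vec ?p (\<lambda>k. w $ k - \<alpha> $ k * v $ k)"
  have ab: "a \<in> carrier_vec ?p" "b \<in> carrier_vec ?p" by (auto simp: a_def b_def)
  have dv: "diag_of_vec d *\<^sub>v u = vec ?p (\<lambda>k. d $ k * u $ k)"
    if "d \<in> carrier_vec ?p" "u \<in> carrier_vec ?p" for d u
    using mat_diag_mult_vec[OF that(2)] that(1) by (simp add: diag_of_vec_def)
  have Psiz: "?Psi *\<^sub>v (v @\<^sub>v w) = a @\<^sub>v b"
  proof -
    have "?Psi *\<^sub>v (v @\<^sub>v w)
        = (diag_of_vec \<beta> *\<^sub>v v + - 1\<^sub>m ?p *\<^sub>v w) @\<^sub>v (- diag_of_vec \<alpha> *\<^sub>v v + 1\<^sub>m ?p *\<^sub>v w)"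
      unfolding Psi_phi_def
      by (rule four_block_mat_mult_vec[of _ ?p ?p _ ?p _ ?p])
        (use \<alpha> \<beta> v w diag_of_vec_carrier in auto)
    also have "diag_of_vec \<beta> *\<^sub>v v + - 1\<^sub>m ?p *\<^sub>v w = a"
      unfolding a_def using w v \<beta> by (intro eq_vecI) (auto simp: dv uminus_mult_mat_vec)
    also have "- diag_of_vec \<alpha> *\<^sub>v v + 1\<^sub>m ?p *\<^sub>v w = b"
      unfolding b_def using w v \<alpha> diag_of_vec_carrier[OF \<alpha>]
      by (intro eq_vecI) (auto simp: dv uminus_mult_mat_vec)
    finally show ?thesis .
  qed
  have "X_mat N \<alpha> \<beta> lam *\<^sub>v ?z
      = transpose_mat ?R *\<^sub>v (transpose_mat ?Psi *\<^sub>v (?M *\<^sub>v (?Psi *\<^sub>v (?R *\<^sub>v ?z))))"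
  proof -
    let ?q = "?p + ?p" and ?r = "in_dim N + ?p"
    note tR = iffD2[OF transpose_carrier_mat R] and tPsi = iffD2[OF transpose_carrier_mat Psi]
    note RP = mult_carrier_mat[OF tR tPsi]
    note RPM = mult_carrier_mat[OF RP M]
    note RPMP = mult_carrier_mat[OF RPM Psi]
    have c1: "?R *\<^sub>v ?z \<in> carrier_vec ?q" using R z by auto
    have c2: "?Psi *\<^sub>v (?R *\<^sub>v ?z) \<in> carrier_vec ?q" using Psi c1 by auto
    have c3: "?M *\<^sub>v (?Psi *\<^sub>v (?R *\<^sub>v ?z)) \<in> carrier_vec ?q" using M c2 by auto
    show ?thesis unfolding X_mat_def assoc_mult_mat_vec[OF RPMP R z] assoc_mult_mat_vec[OF RPM Psi c1]
        assoc_mult_mat_vec[OF RP M c2] assoc_mult_mat_vec[OF tR tPsi c3] ..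
  qed
  also have "\<dots> = transpose_mat ?R *\<^sub>v (transpose_mat ?Psi *\<^sub>v (?M *\<^sub>v (a @\<^sub>v b)))"
    unfolding Rz Psiz ..
  also have "?z \<bullet> \<dots> = (transpose_mat ?Psi *\<^sub>v (?M *\<^sub>v (a @\<^sub>v b))) \<bullet> (v @\<^sub>v w)"
    unfolding Rz[symmetric]
    by (rule scalar_prod_transpose_mult_vec[OF R z]) (use Psi M ab in auto)
  also have "\<dots> = (v @\<^sub>v w) \<bullet> (transpose_mat ?Psi *\<^sub>v (?M *\<^sub>v (a @\<^sub>v b)))"
    by (rule comm_scalar_prod[of _ "?p + ?p"]) (use Psi M ab v w in auto)
  also have "\<dots> = (?M *\<^sub>v (a @\<^sub>v b)) \<bullet> (a @\<^sub>v b)"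
    unfolding Psiz[symmetric]
    by (rule scalar_prod_transpose_mult_vec[OF Psi]) (use Psi M ab v w in auto)
  also have "\<dots> = quad ?M (a @\<^sub>v b)"
    by (rule comm_scalar_prod[of _ "?p + ?p"]) (use M ab in auto)
  also have "\<dots> = a \<bullet> (diag_of_vec lam *\<^sub>v b) + b \<bullet> (diag_of_vec lam *\<^sub>v a)"
    unfolding M_phi_def
    using quad_four_block[OF zero_carrier_mat diag_of_vec_carrier[OF lam] diag_of_vec_carrier[OF lam]
        zero_carrier_mat ab] quad_zero ab by simp
  also have "\<dots> = 2 * (\<Sum>k<?p. lam $ k * (a $ k * b $ k))"
    unfolding dv[OF lam ab(1)] dv[OF lam ab(2)] using ab
    by (simp add: scalar_prod_def lessThan_atLeast0 mult_ac)
  also have "\<dots> = 2 * (\<Sum>k<?p. lam $ k * ((\<beta> $ k * v $ k - w $ k) * (w $ k - \<alpha> $ k * v $ k)))"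
    by (simp add: a_def b_def)
  finally show ?thesis .
qed

text \<open>The projection \<open>[I 0] R\<^sub>V\<close> extracts \<open>x\<close> from \<open>(x, w)\<close>, which leaves \<open>- x \<bullet> P x\<close>.\<close>

lemma quad_Z_mat:
  assumes net: "wf_network N" and plant: "wf_plant S (in_dim N) m"
    and P: "P \<in> carrier_mat (in_dim N) (in_dim N)"
    and x: "x \<in> carrier_vec (in_dim N)" and w: "w \<in> carrier_vec (n_phi N)" and y: "y \<in> carrier_vec (in_dim N)"
  shows "quad (Z_mat N S \<alpha> \<beta> lam P) ((x @\<^sub>v w) @\<^sub>v y)
    = - quad P x + quad (X_mat N \<alpha> \<beta> lam) (x @\<^sub>v w) + 2 * (y \<bullet> (P *\<^sub>v (A_0 S *\<^sub>v x + B_0 N S *\<^sub>v w))) - quad P y"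
proof -
  let ?n = "in_dim N" and ?m = "out_dim N" and ?p = "n_phi N" and ?z = "x @\<^sub>v w"
  let ?L = "P * (A_0 S @\<^sub>c B_0 N S)" and ?G = "1\<^sub>m ?n @\<^sub>r 0\<^sub>m ?m ?n" and ?J = "1\<^sub>m ?n @\<^sub>c 0\<^sub>m ?n ?m"
  let ?K = "transpose_mat (R_V N) * ?G * P * ?J * R_V N"
  have z: "?z \<in> carrier_vec (?n + ?p)" using x w by auto
  note R = R_V_carrier[OF net] and X = X_mat_carrier[OF net, of \<alpha> \<beta> lam]
  note tR = iffD2[OF transpose_carrier_mat R]
  have AB: "A_0 S @\<^sub>c B_0 N S \<in> carrier_mat ?n (?n + ?p)"
    by (rule append_cols_carrier[OF A_0_carrier[OF plant] B_0_carrier])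
  have L: "?L \<in> carrier_mat ?n (?n + ?p)" using P AB by auto
  have G: "?G \<in> carrier_mat (?n + ?m) ?n" by (intro carrier_append_rows) auto
  have J: "?J \<in> carrier_mat ?n (?n + ?m)" by (intro append_cols_carrier) auto
  note tRG = mult_carrier_mat[OF tR G]
  note tRGP = mult_carrier_mat[OF tRG P]
  note tRGPJ = mult_carrier_mat[OF tRGP J]
  have K: "?K \<in> carrier_mat (?n + ?p) (?n + ?p)" using tRGPJ R by auto
  have u: "N_uw N *\<^sub>v w \<in> carrier_vec ?m" using N_uw_carrier[OF net] w by auto
  have Rz: "R_V N *\<^sub>v ?z = x @\<^sub>v N_uw N *\<^sub>v w"
  proof -
    have "N_ux N \<in> carrier_mat ?m ?n" by (simp add: N_ux_def)
    then show ?thesis unfolding R_V_def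
      by (subst four_block_mat_mult_vec[OF one_carrier_mat zero_carrier_mat _ N_uw_carrier[OF net] x w])
        (use x w u in \<open>auto simp: zero_mat_mult_vec N_ux_def\<close>)
  qed
  have Rzc: "R_V N *\<^sub>v ?z \<in> carrier_vec (?n + ?m)" unfolding Rz using x u by auto
  have Jx: "?J *\<^sub>v (R_V N *\<^sub>v ?z) = x"
    unfolding Rz using append_cols_mult_vec[OF one_carrier_mat zero_carrier_mat x u] x u
    by (simp add: zero_mat_mult_vec)
  have Px: "P *\<^sub>v x \<in> carrier_vec ?n" using P x by auto
  have "?K *\<^sub>v ?z = transpose_mat (R_V N) *\<^sub>v (?G *\<^sub>v (P *\<^sub>v x))"
    using assoc_mult_mat_vec[OF tRGPJ R z] assoc_mult_mat_vec[OF tRGP J Rzc]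
      assoc_mult_mat_vec[OF tRG P x] assoc_mult_mat_vec[OF tR G Px] Jx by simp
  also have "?z \<bullet> \<dots> = (?G *\<^sub>v (P *\<^sub>v x)) \<bullet> (R_V N *\<^sub>v ?z)"
    by (rule scalar_prod_transpose_mult_vec[OF R z mult_mat_vec_carrier[OF G Px]])
  also have "?G *\<^sub>v (P *\<^sub>v x) = P *\<^sub>v x @\<^sub>v 0\<^sub>v ?m"
    using mat_mult_append[OF one_carrier_mat zero_carrier_mat Px, of ?m] Px
    by (simp add: zero_mat_mult_vec)
  also have "(P *\<^sub>v x @\<^sub>v 0\<^sub>v ?m) \<bullet> (R_V N *\<^sub>v ?z) = (P *\<^sub>v x) \<bullet> x"
    unfolding Rz by (subst scalar_prod_append[OF Px zero_carrier_vec x u]) (use u in simp)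
  also have "\<dots> = quad P x" by (rule comm_scalar_prod[OF Px x])
  finally have quadK: "quad ?K ?z = quad P x" .
  have Lz: "?L *\<^sub>v ?z = P *\<^sub>v (A_0 S *\<^sub>v x + B_0 N S *\<^sub>v w)"
    using assoc_mult_mat_vec[OF P AB z] append_cols_mult_vec[OF A_0_carrier[OF plant] B_0_carrier x w] by simp
  have nK: "- ?K \<in> carrier_mat (?n + ?p) (?n + ?p)" by (rule uminus_carrier_mat[OF K])
  have KX: "- ?K + X_mat N \<alpha> \<beta> lam \<in> carrier_mat (?n + ?p) (?n + ?p)" using X by simp
  show ?thesis
    unfolding Z_mat_def Let_def quad_four_block_sym[OF KX L uminus_carrier_mat[OF P] z y]
      quad_add[OF nK X z] quad_uminus[OF K z] quad_uminus[OF P y] quadK Lz by simp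
qed

text \<open>The interval product \<open>B N\<^sub>u\<^sub>w\<close> has bounded entries, so infimum and supremum really bound them.\<close>

lemma BN_bounds:
  assumes net: "wf_network N" and plant: "wf_plant S (in_dim N) (out_dim N)" and B: "B \<in> {B_lo S..B_hi S}"
    and i: "i < in_dim N" and j: "j < n_phi N"
  shows "BN_lo N S $$ (i, j) \<le> (B * N_uw N) $$ (i, j)" "(B * N_uw N) $$ (i, j) \<le> BN_hi N S $$ (i, j)"
proof -
  let ?m = "out_dim N" and ?U = "N_uw N"
  let ?C = "\<Sum>k<?m. (\<bar>B_lo S $$ (i, k)\<bar> + \<bar>B_hi S $$ (i, k)\<bar>) * \<bar>?U $$ (k, j)\<bar>"
  have bound: "\<bar>(B * ?U) $$ (i, j)\<bar> \<le> ?C" if B: "B \<in> {B_lo S..B_hi S}" for B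
  proof -
    have Bc: "B \<in> carrier_mat (in_dim N) ?m" and
      entry: "\<And>k. k < ?m \<Longrightarrow> B_lo S $$ (i, k) \<le> B $$ (i, k) \<and> B $$ (i, k) \<le> B_hi S $$ (i, k)"
      using B plant i by (auto simp: wf_plant_def less_eq_mat_def)
    have "(B * ?U) $$ (i, j) = (\<Sum>k<?m. B $$ (i, k) * ?U $$ (k, j))"
      using Bc N_uw_carrier[OF net] i j by (auto simp: scalar_prod_def lessThan_atLeast0)
    then have "\<bar>(B * ?U) $$ (i, j)\<bar> \<le> (\<Sum>k<?m. \<bar>B $$ (i, k) * ?U $$ (k, j)\<bar>)" by (simp add: sum_abs)
    also have "\<dots> \<le> ?C"
    proof (intro sum_mono)
      fix k assume "k \<in> {..<?m}"
      then have "\<bar>B $$ (i, k)\<bar> \<le> \<bar>B_lo S $$ (i, k)\<bar> + \<bar>B_hi S $$ (i, k)\<bar>" using entry[of k] by auto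
      then show "\<bar>B $$ (i, k) * ?U $$ (k, j)\<bar> \<le> (\<bar>B_lo S $$ (i, k)\<bar> + \<bar>B_hi S $$ (i, k)\<bar>) * \<bar>?U $$ (k, j)\<bar>"
        by (simp add: abs_mult mult_right_mono)
    qed
    finally show ?thesis .
  qed
  have "bdd_below ((\<lambda>B. (B * ?U) $$ (i, j)) ` {B_lo S..B_hi S})"
    by (rule bdd_belowI2[of _ "- ?C"]) (use bound in \<open>simp add: abs_le_iff minus_le_iff\<close>)
  from cINF_lower[OF this B] show "BN_lo N S $$ (i, j) \<le> (B * ?U) $$ (i, j)"
    using i j by (simp add: BN_lo_def)
  have "bdd_above ((\<lambda>B. (B * ?U) $$ (i, j)) ` {B_lo S..B_hi S})"
    by (rule bdd_aboveI2[of _ _ ?C]) (use bound in \<open>simp add: abs_le_iff\<close>)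
  from cSUP_upper[OF B this] show "(B * ?U) $$ (i, j) \<le> BN_hi N S $$ (i, j)"
    using i j by (simp add: BN_hi_def)
qed

lemma deviation_bound:
  assumes net: "wf_network N" and plant: "wf_plant S (in_dim N) (out_dim N)"
    and A: "A \<in> {A_lo S..A_hi S}" and B: "B \<in> {B_lo S..B_hi S}"
  defines "E \<equiv> (A - A_0 S) @\<^sub>c (B * N_uw N - B_0 N S) @\<^sub>c 0\<^sub>m (in_dim N) (in_dim N)"
  shows "\<forall>i<n_hat N. \<forall>j<in_dim N. \<bar>E $$ (j, i)\<bar> \<le> D_mat N S $$ (i, j)"
proof (intro allI impI)
  let ?n = "in_dim N" and ?p = "n_phi N"
  fix i j assume i: "i < n_hat N" and j: "j < ?n"
  have Ac: "A - A_0 S \<in> carrier_mat ?n ?n" using A_0_carrier[OF plant] by (rule minus_carrier_mat)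
  have Bc: "B * N_uw N - B_0 N S \<in> carrier_mat ?n ?p" by (rule minus_carrier_mat[OF B_0_carrier])
  have i': "i < ?n + (?p + ?n)" using i by (simp add: n_hat_def)
  have E2: "(B * N_uw N - B_0 N S) @\<^sub>c 0\<^sub>m ?n ?n \<in> carrier_mat ?n (?p + ?n)"
    by (intro append_cols_carrier Bc) simp
  have D2: "B_r N S @\<^sub>c 0\<^sub>m ?n ?n \<in> carrier_mat ?n (?p + ?n)"
    by (intro append_cols_carrier B_r_carrier) simp
  have "D_mat N S $$ (i, j) = (A_r S @\<^sub>c B_r N S @\<^sub>c 0\<^sub>m ?n ?n) $$ (j, i)"
    unfolding D_mat_def
    using append_cols_carrier[OF A_r_carrier[OF plant] D2] i' j by (intro index_transpose_mat) auto
  also have "\<dots> = (if i < ?n then A_r S $$ (j, i)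
      else if i - ?n < ?p then B_r N S $$ (j, i - ?n) else 0)"
    using append_cols_index[OF A_r_carrier[OF plant] D2 j i']
      append_cols_index[OF B_r_carrier zero_carrier_mat j, of "i - ?n" ?n] i' j by auto
  finally have D: "D_mat N S $$ (i, j) = (if i < ?n then A_r S $$ (j, i)
      else if i - ?n < ?p then B_r N S $$ (j, i - ?n) else 0)" .
  have E: "E $$ (j, i) = (if i < ?n then (A - A_0 S) $$ (j, i)
      else if i - ?n < ?p then (B * N_uw N - B_0 N S) $$ (j, i - ?n) else 0)"
    unfolding E_def using append_cols_index[OF Ac E2 j i']
      append_cols_index[OF Bc zero_carrier_mat j, of "i - ?n" ?n] i' j by auto
  have "\<bar>(A - A_0 S) $$ (j, i)\<bar> \<le> A_r S $$ (j, i)" if "i < ?n"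
  proof -
    have "A_lo S $$ (j, i) \<le> A $$ (j, i)" "A $$ (j, i) \<le> A_hi S $$ (j, i)"
      using A plant that j by (auto simp: wf_plant_def less_eq_mat_def)
    then show ?thesis
      using plant that j by (auto simp: wf_plant_def A_0_def A_r_def abs_le_iff field_simps)
  qed
  moreover have "\<bar>(B * N_uw N - B_0 N S) $$ (j, l)\<bar> \<le> B_r N S $$ (j, l)" if "l < ?p" for l
    using BN_bounds[OF net plant B j that] j that
    by (auto simp: B_0_def B_r_def BN_lo_def BN_hi_def abs_le_iff field_simps)
  ultimately show "\<bar>E $$ (j, i)\<bar> \<le> D_mat N S $$ (i, j)" unfolding D E by auto
qed

text \<open>Taking \<open>y\<close> to be the successor state turns \<open>2 y \<bullet> P y - y \<bullet> P y\<close> into its Lyapunov value.\<close>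

lemma robust_Lyapunov_decrease:
  assumes net: "wf_network N" and plant: "wf_plant S (in_dim N) (out_dim N)"
    and P: "P \<in> carrier_mat (in_dim N) (in_dim N)" "symmetric_mat P"
    and \<epsilon>: "\<epsilon> > 0" "robustly_negative N S (Z_mat N S \<alpha> \<beta> lam P) P \<epsilon>"
    and A: "A \<in> {A_lo S..A_hi S}" and B: "B \<in> {B_lo S..B_hi S}"
    and x: "x \<in> carrier_vec (in_dim N)" and w: "w \<in> carrier_vec (n_phi N)"
  defines "y \<equiv> A *\<^sub>v x + B *\<^sub>v (N_uw N *\<^sub>v w)"
  shows "quad P y - quad P x + quad (X_mat N \<alpha> \<beta> lam) (x @\<^sub>v w) + \<epsilon> * (x \<bullet> x) \<le> 0"
proof -
  let ?n = "in_dim N" and ?p = "n_phi N" and ?z = "x @\<^sub>v w"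
  let ?E1 = "A - A_0 S" and ?E2 = "B * N_uw N - B_0 N S"
  let ?E = "?E1 @\<^sub>c ?E2 @\<^sub>c 0\<^sub>m ?n ?n"
  have Ac: "A \<in> carrier_mat ?n ?n" and Bc: "B \<in> carrier_mat ?n (out_dim N)"
    using A B plant by (auto simp: wf_plant_def less_eq_mat_def)
  note A0 = A_0_carrier[OF plant] and B0 = B_0_carrier[of N S] and U = N_uw_carrier[OF net]
  note BU = mult_carrier_mat[OF Bc U]
  have y: "y \<in> carrier_vec ?n" unfolding y_def using Ac Bc U x w by auto
  have z: "?z \<in> carrier_vec (?n + ?p)" using x w by auto
  have E1: "?E1 \<in> carrier_mat ?n ?n" using A0 by (rule minus_carrier_mat)
  have E2: "?E2 \<in> carrier_mat ?n ?p" using B0 by (rule minus_carrier_mat)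
  have E3: "?E2 @\<^sub>c 0\<^sub>m ?n ?n \<in> carrier_mat ?n (?p + ?n)" by (intro append_cols_carrier E2) simp
  have E: "?E \<in> carrier_mat ?n (n_hat N)"
    using append_cols_carrier[OF E1 E3] by (simp add: n_hat_eq add.assoc)
  define c where "c = A_0 S *\<^sub>v x + B_0 N S *\<^sub>v w"
  have c: "c \<in> carrier_vec ?n" unfolding c_def using A0 B0 x w by auto
  have "?E *\<^sub>v (?z @\<^sub>v y) = ?E *\<^sub>v (x @\<^sub>v (w @\<^sub>v y))"
    by (intro arg_cong[of _ _ "\<lambda>u. ?E *\<^sub>v u"] eq_vecI) auto
  also have "\<dots> = ?E1 *\<^sub>v x + (?E2 @\<^sub>c 0\<^sub>m ?n ?n) *\<^sub>v (w @\<^sub>v y)"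
    by (rule append_cols_mult_vec[OF E1 E3 x]) (use w y in auto)
  also have "(?E2 @\<^sub>c 0\<^sub>m ?n ?n) *\<^sub>v (w @\<^sub>v y) = ?E2 *\<^sub>v w + 0\<^sub>m ?n ?n *\<^sub>v y"
    by (rule append_cols_mult_vec[OF E2 zero_carrier_mat w y])
  also have "?E1 *\<^sub>v x + \<dots> = y - c"
    unfolding y_def c_def zero_mat_mult_vec[OF y] minus_mult_distrib_mat_vec[OF Ac A0 x]
      minus_mult_distrib_mat_vec[OF BU B0 w] assoc_mult_mat_vec[OF Bc U w]
    using Ac Bc A0 B0 U x w by (intro eq_vecI) auto
  finally have Ez: "?E *\<^sub>v (?z @\<^sub>v y) = y - c" .
  have Py: "P *\<^sub>v y \<in> carrier_vec ?n" using P y by auto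
  have "(P *\<^sub>v y) \<bullet> (y - c) = quad P y - y \<bullet> (P *\<^sub>v c)"
    using comm_scalar_prod[OF Py y] comm_scalar_prod[OF Py c]
      symmetric_mat_scalar_prod_swap[OF P(2,1) y c] scalar_prod_minus_distrib[OF Py y c] by simp
  moreover have "quad (Z_mat N S \<alpha> \<beta> lam P) (?z @\<^sub>v y) + 2 * ((P *\<^sub>v y) \<bullet> (?E *\<^sub>v (?z @\<^sub>v y)))
      + \<epsilon> * ((?z @\<^sub>v y) \<bullet> (?z @\<^sub>v y)) \<le> 0"
    using \<epsilon>(2) E deviation_bound[OF net plant A B] z y unfolding robustly_negative_def by blast
  moreover have "(?z @\<^sub>v y) \<bullet> (?z @\<^sub>v y) = x \<bullet> x + w \<bullet> w + y \<bullet> y"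
    using scalar_prod_append[OF z y z y] scalar_prod_append[OF x w x w] by simp
  moreover have "\<epsilon> * (x \<bullet> x) \<le> \<epsilon> * (x \<bullet> x + w \<bullet> w + y \<bullet> y)"
    using \<epsilon>(1) scalar_prod_self_nonneg[of w] scalar_prod_self_nonneg[of y] by simp
  ultimately show ?thesis
    unfolding Ez quad_Z_mat[OF net plant P(1) x w y] c_def by simp
qed

section \<open>Sector bounds on the ellipsoid\<close>

lemma layer_in_1: "layer_in N x 1 = weight N 1 *\<^sub>v x + bias N 1"
  by (simp add: layer_in_def)

text \<open>Cauchy-Schwarz for the block matrix of condition (N), applied to \<open>(1, 0)\<close> and \<open>(0, x)\<close>.\<close>

lemma cond_N_row_bound:
  assumes net: "wf_network N" and P: "P \<in> carrier_mat (in_dim N) (in_dim N)"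
    and N: "cond_N N vhi1 P" and x: "x \<in> carrier_vec (in_dim N)" and i: "i < width N 1"
  shows "(row (weight N 1) i \<bullet> x)\<^sup>2 \<le> (vhi1 $ i - layer_in N (0\<^sub>v (in_dim N)) 1 $ i)\<^sup>2 * quad P x"
proof -
  let ?n = "in_dim N"
  let ?d = "vhi1 $ i - layer_in N (0\<^sub>v ?n) 1 $ i" and ?w = "mat_of_row (row (weight N 1) i)"
  let ?C = "mat 1 1 (\<lambda>_. ?d\<^sup>2)"
  let ?M = "four_block_mat ?C ?w (transpose_mat ?w) P"
  have "weight N 1 \<in> carrier_mat (width N 1) ?n"
    using weight_carrier[OF net, of 1] by (simp add: in_dim_def)
  then have r: "row (weight N 1) i \<in> carrier_vec ?n" using i by auto
  then have w: "?w \<in> carrier_mat 1 ?n" by auto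
  have psd: "pos_semidef ?M" using N i unfolding cond_N_def Let_def by blast
  have C: "?C \<in> carrier_mat 1 1" by simp
  have tw: "transpose_mat ?w \<in> carrier_mat ?n 1" using w by simp
  have M: "?M \<in> carrier_mat (1 + ?n) (1 + ?n)" by (rule four_block_carrier_mat[OF C P])
  let ?e = "vec 1 (\<lambda>_. 1 :: real)"
  have e: "?e \<in> carrier_vec 1" by simp
  have e_prod: "?e \<bullet> vec 1 (\<lambda>_. a) = a" for a by (simp add: scalar_prod_def)
  have wx: "?w *\<^sub>v x = vec 1 (\<lambda>_. row (weight N 1) i \<bullet> x)"
    by (intro eq_vecI) (simp_all del: One_nat_def)
  then have wxc: "?w *\<^sub>v x \<in> carrier_vec 1" by simp
  have Px: "P *\<^sub>v x \<in> carrier_vec ?n" using P x by auto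
  have C0: "?C *\<^sub>v 0\<^sub>v 1 = 0\<^sub>v 1" by (rule mat_mult_zero_vec[OF C])
  have tw0: "transpose_mat ?w *\<^sub>v 0\<^sub>v 1 = 0\<^sub>v ?n" by (rule mat_mult_zero_vec[OF tw])
  have "?M *\<^sub>v (0\<^sub>v 1 @\<^sub>v x) = (?C *\<^sub>v 0\<^sub>v 1 + ?w *\<^sub>v x) @\<^sub>v (transpose_mat ?w *\<^sub>v 0\<^sub>v 1 + P *\<^sub>v x)"
    by (rule four_block_mat_mult_vec[OF C w tw P zero_carrier_vec x])
  also have "\<dots> = ?w *\<^sub>v x @\<^sub>v P *\<^sub>v x"
    unfolding C0 tw0 wx using left_zero_vec[OF Px] by (simp add: left_zero_vec[of _ 1])
  finally have "(?e @\<^sub>v 0\<^sub>v ?n) \<bullet> (?M *\<^sub>v (0\<^sub>v 1 @\<^sub>v x)) = ?e \<bullet> (?w *\<^sub>v x) + 0\<^sub>v ?n \<bullet> (P *\<^sub>v x)"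
    using scalar_prod_append[OF e zero_carrier_vec[of ?n] wxc Px] by (simp only:)
  then have "(?e @\<^sub>v 0\<^sub>v ?n) \<bullet> (?M *\<^sub>v (0\<^sub>v 1 @\<^sub>v x)) = row (weight N 1) i \<bullet> x"
    unfolding wx e_prod scalar_prod_left_zero[OF Px] by simp
  moreover have "quad ?M (0\<^sub>v 1 @\<^sub>v x) = quad P x"
    unfolding quad_four_block[OF C w tw P zero_carrier_vec x] C0 tw0 scalar_prod_left_zero[OF wxc]
      scalar_prod_left_zero[OF zero_carrier_vec] scalar_prod_right_zero[OF x] by simp
  moreover have "quad ?M (?e @\<^sub>v 0\<^sub>v ?n) = ?d\<^sup>2"
  proof -
    have Ce: "?C *\<^sub>v ?e = vec 1 (\<lambda>_. ?d\<^sup>2)" by (intro eq_vecI) (auto simp: scalar_prod_def)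
    have twe: "transpose_mat ?w *\<^sub>v ?e \<in> carrier_vec ?n" by (rule mult_mat_vec_carrier[OF tw e])
    show ?thesis
      unfolding quad_four_block[OF C w tw P e zero_carrier_vec] Ce e_prod mat_mult_zero_vec[OF w]
        mat_mult_zero_vec[OF P] scalar_prod_left_zero[OF twe] scalar_prod_right_zero[OF e]
        scalar_prod_left_zero[OF zero_carrier_vec] by simp
  qed
  ultimately show ?thesis
    using pos_semidef_Cauchy_Schwarz[OF psd M append_carrier_vec[OF zero_carrier_vec x]
        append_carrier_vec[OF e zero_carrier_vec]] by (simp only:)
qed

lemma first_layer_in_bounds:
  assumes net: "wf_network N" and P: "P \<in> carrier_mat (in_dim N) (in_dim N)"
    and vhi1: "vhi1 \<in> carrier_vec (width N 1)" "layer_in N (0\<^sub>v (in_dim N)) 1 \<le> vhi1"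
    and N: "cond_N N vhi1 P" and x: "x \<in> carrier_vec (in_dim N)" "quad P x \<le> 1"
  shows "2 \<cdot>\<^sub>v layer_in N (0\<^sub>v (in_dim N)) 1 - vhi1 \<le> layer_in N x 1 \<and> layer_in N x 1 \<le> vhi1"
proof -
  let ?v0 = "layer_in N (0\<^sub>v (in_dim N)) 1"
  have W: "weight N 1 \<in> carrier_mat (width N 1) (in_dim N)" and b: "bias N 1 \<in> carrier_vec (width N 1)"
    using net weight_carrier[OF net, of 1] by (simp_all add: wf_network_def in_dim_def)
  have v0: "?v0 \<in> carrier_vec (width N 1)" and vx: "layer_in N x 1 \<in> carrier_vec (width N 1)"
    unfolding layer_in_1 using W b x by auto
  have key: "\<bar>layer_in N x 1 $ i - ?v0 $ i\<bar> \<le> vhi1 $ i - ?v0 $ i" if i: "i < width N 1" for i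
  proof -
    have d: "vhi1 $ i - ?v0 $ i \<ge> 0" using vhi1 i by (auto simp: less_eq_vec_def)
    have "layer_in N x 1 $ i - ?v0 $ i = row (weight N 1) i \<bullet> x"
      unfolding layer_in_1 using W b x i by simp
    then have "(layer_in N x 1 $ i - ?v0 $ i)\<^sup>2 \<le> (vhi1 $ i - ?v0 $ i)\<^sup>2 * quad P x"
      using cond_N_row_bound[OF net P N x(1) i] by simp
    also have "\<dots> \<le> (vhi1 $ i - ?v0 $ i)\<^sup>2" using x(2) by (simp add: mult_left_le)
    finally show ?thesis using d by (metis abs_le_square_iff abs_of_nonneg)
  qed
  show ?thesis
  proof (unfold less_eq_vec_def, intro conjI allI impI)
    fix i assume "i < dim_vec (layer_in N x 1)"
    then have i: "i < width N 1" using vx by simp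
    have "(2 \<cdot>\<^sub>v ?v0 - vhi1) $ i = 2 * ?v0 $ i - vhi1 $ i" using v0 vhi1(1) i by simp
    then show "(2 \<cdot>\<^sub>v ?v0 - vhi1) $ i \<le> layer_in N x 1 $ i" using key[OF i] by linarith
  next
    fix i assume "i < dim_vec vhi1"
    then show "layer_in N x 1 $ i \<le> vhi1 $ i" using key[of i] vhi1(1) by simp
  qed (use v0 vx vhi1(1) in simp_all)
qed

text \<open>The deviation of \<open>v\<^sub>\<phi>\<close> from \<open>v\<^sub>*\<close> is \<open>N\<^sub>v\<^sub>x x + N\<^sub>v\<^sub>w w\<close>, since the biases cancel. So the
  summands of the form are the negated sector products, weighted with \<open>\<lambda> \<ge> 0\<close>.\<close>

lemma quad_X_mat_nonneg_if_sector:
  assumes net: "wf_network N" and \<alpha>: "\<alpha> \<in> carrier_vec (n_phi N)" and \<beta>: "\<beta> \<in> carrier_vec (n_phi N)"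
    and lam: "lam \<in> carrier_vec (n_phi N)" "0\<^sub>v (n_phi N) \<le> lam"
    and sector: "\<forall>k<n_phi N. locally_sector_bounded (activation N) (\<alpha> $ k) (\<beta> $ k)
      (v_phi N (0\<^sub>v (in_dim N)) $ k) (vlo $ k) (vhi $ k)"
    and x: "x \<in> carrier_vec (in_dim N)" and v: "vlo \<le> v_phi N x" "v_phi N x \<le> vhi"
  shows "0 \<le> quad (X_mat N \<alpha> \<beta> lam) (x @\<^sub>v (w_phi N x - w_phi N (0\<^sub>v (in_dim N))))"
proof -
  let ?p = "n_phi N" and ?o = "0\<^sub>v (in_dim N) :: real vec"
  let ?w = "w_phi N x - w_phi N ?o"
  let ?v = "N_vx N *\<^sub>v x + N_vw N *\<^sub>v ?w"
  note Nvx = N_vx_carrier[OF net] and Nvw = N_vw_carrier[OF net]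
  note wc = w_phi_carrier[OF net]
  have bc: "stack (bias N) (depth N) \<in> carrier_vec ?p"
    unfolding n_phi_def using net by (intro stack_carrier) (auto simp: wf_network_def)
  have o: "?o \<in> carrier_vec (in_dim N)" by simp
  have vc: "v_phi N y \<in> carrier_vec ?p" if "y \<in> carrier_vec (in_dim N)" for y
    unfolding v_phi_eq[OF net that] using Nvx Nvw wc[OF that] bc that by auto
  have w: "?w \<in> carrier_vec ?p" by (rule minus_carrier_vec[OF wc[OF x] wc[OF o]])
  have v_diff: "?v $ k = v_phi N x $ k - v_phi N ?o $ k" if "k < ?p" for k
    unfolding v_phi_eq[OF net x] v_phi_eq[OF net o] mult_minus_distrib_mat_vec[OF Nvw wc[OF x] wc[OF o]]
    using that Nvx Nvw wc[OF x] wc[OF o] bc x by simp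
  have pos: "0 \<le> lam $ k * ((\<beta> $ k * ?v $ k - ?w $ k) * (?w $ k - \<alpha> $ k * ?v $ k))" if k: "k < ?p" for k
  proof (rule mult_nonneg_nonneg)
    show "0 \<le> lam $ k" using lam k by (auto simp: less_eq_vec_def)
    have "v_phi N x $ k \<in> {vlo $ k..vhi $ k}" using v k vc[OF x] by (auto simp: less_eq_vec_def)
    moreover have "?w $ k = activation N (v_phi N x $ k) - activation N (v_phi N ?o $ k)"
      using k vc[OF x] vc[OF o] unfolding w_phi_eq[OF net x] w_phi_eq[OF net o] by simp
    ultimately have "(?w $ k - \<alpha> $ k * ?v $ k) * (?w $ k - \<beta> $ k * ?v $ k) \<le> 0"
      using sector k unfolding locally_sector_bounded_def v_diff[OF k] by metis
    then show "0 \<le> (\<beta> $ k * ?v $ k - ?w $ k) * (?w $ k - \<alpha> $ k * ?v $ k)"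
      by (simp add: algebra_simps)
  qed
  show ?thesis unfolding quad_X_mat[OF net \<alpha> \<beta> lam(1) x w]
    by (rule mult_nonneg_nonneg[OF zero_le_numeral sum_nonneg], rule pos, simp)
qed

lemma net_map_carrier:
  assumes "wf_network N"
  shows "net_map N x \<in> carrier_vec (out_dim N)"
proof -
  have "bias N (depth N + 1) \<in> carrier_vec (out_dim N)"
    using assms by (auto simp: wf_network_def out_dim_def)
  then have "dim_vec (bias N (depth N + 1)) = out_dim N" by (rule carrier_vecD)
  then show ?thesis unfolding net_map_def by (intro carrier_vecI) simp
qed

lemma net_map_deviation:
  assumes net: "wf_network N" and zero: "net_map N (0\<^sub>v (in_dim N)) = 0\<^sub>v (out_dim N)"
    and x: "x \<in> carrier_vec (in_dim N)"
  shows "net_map N x = N_uw N *\<^sub>v (w_phi N x - w_phi N (0\<^sub>v (in_dim N)))"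
proof -
  let ?o = "0\<^sub>v (in_dim N) :: real vec"
  have o: "?o \<in> carrier_vec (in_dim N)" by simp
  note wc = w_phi_carrier[OF net]
  have b: "bias N (depth N + 1) \<in> carrier_vec (out_dim N)" using net by (auto simp: wf_network_def out_dim_def)
  note U = N_uw_carrier[OF net]
  have eq: "net_map N y = N_uw N *\<^sub>v w_phi N y + bias N (depth N + 1)" if "y \<in> carrier_vec (in_dim N)" for y
    unfolding net_map_eq[OF net that] N_ux_def zero_mat_mult_vec[OF that] using U wc[OF that] by simp
  have "net_map N x = net_map N x - net_map N ?o"
    unfolding zero using eq[OF x] U wc[OF x] b by simp
  also have "\<dots> = N_uw N *\<^sub>v w_phi N x - N_uw N *\<^sub>v w_phi N ?o"
    unfolding eq[OF x] eq[OF o] using U wc[OF x] wc[OF o] b by (intro eq_vecI) auto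
  also have "\<dots> = N_uw N *\<^sub>v (w_phi N x - w_phi N ?o)"
    by (rule mult_minus_distrib_mat_vec[OF U wc[OF x] wc[OF o], symmetric])
  finally show ?thesis .
qed

section \<open>From a decreasing quadratic form to stability\<close>

lemma vnorm_nonneg: "vnorm x \<ge> 0"
  by (simp add: vnorm_def scalar_prod_self_nonneg)

lemma vnorm_power2: "(vnorm x)\<^sup>2 = x \<bullet> x"
  by (simp add: vnorm_def scalar_prod_self_nonneg)

text \<open>On the sublevel set, comparison of \<open>x \<bullet> x\<close> with the form turns the decrease into contraction
  by the factor \<open>1 - \<epsilon> / K\<close>, where \<open>K\<close> bounds the form by \<open>K (x \<bullet> x)\<close>. Since the factor is below 1,
  trajectories stay inside, and the estimate can be iterated.\<close>

lemma quadratic_Lyapunov_decay: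
  assumes P: "P \<in> carrier_mat n n" "pos_def P"
    and f: "\<And>x. x \<in> carrier_vec n \<Longrightarrow> f x \<in> carrier_vec n"
    and \<epsilon>: "\<epsilon> > 0"
    and dec: "\<And>x. x \<in> carrier_vec n \<Longrightarrow> quad P x \<le> 1 \<Longrightarrow> quad P (f x) + \<epsilon> * (x \<bullet> x) \<le> quad P x"
  shows "\<exists>C>0. \<exists>\<rho>. 0 \<le> \<rho> \<and> \<rho> < 1 \<and> (\<forall>x\<in>carrier_vec n. quad P x \<le> 1 \<longrightarrow>
    (\<forall>t. (vnorm (trajectory f t x))\<^sup>2 \<le> C * \<rho> ^ t * quad P x))"
proof -
  obtain c where c: "c > 0" "\<forall>x\<in>carrier_vec n. c * (x \<bullet> x) \<le> quad P x"
    using pos_def_lower_bound[OF P(2,1)] by blast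
  obtain K where K: "K > 0" "\<forall>x\<in>carrier_vec n. quad P x \<le> K * (x \<bullet> x)"
    using quad_upper_bound[OF P(1)] by blast
  have nonneg: "quad P x \<ge> 0" if "x \<in> carrier_vec n" for x
    using pos_semidef_if_pos_def[OF P(2)] P(1) that unfolding pos_semidef_def by auto
  \<comment> \<open>the maximum only serves to keep the factor nonnegative when \<open>\<epsilon> > K\<close>\<close>
  define \<rho> where "\<rho> = max 0 (1 - \<epsilon> / K)"
  have \<rho>: "0 \<le> \<rho>" "\<rho> < 1" using \<epsilon> K(1) by (auto simp: \<rho>_def)
  have step: "quad P (f x) \<le> \<rho> * quad P x" if x: "x \<in> carrier_vec n" "quad P x \<le> 1" for x
  proof -
    have "\<epsilon> / K * quad P x \<le> \<epsilon> / K * (K * (x \<bullet> x))"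
      using K x(1) \<epsilon> by (intro mult_left_mono) auto
    then have "quad P (f x) \<le> (1 - \<epsilon> / K) * quad P x"
      using dec[OF x] K(1) by (simp add: algebra_simps)
    also have "\<dots> \<le> \<rho> * quad P x" using nonneg[OF x(1)] by (intro mult_right_mono) (simp add: \<rho>_def)
    finally show ?thesis .
  qed
  have decay: "trajectory f t x \<in> carrier_vec n \<and> quad P (trajectory f t x) \<le> \<rho> ^ t * quad P x"
    if x: "x \<in> carrier_vec n" "quad P x \<le> 1" for x t
  proof (induction t)
    case (Suc t)
    have "\<rho> ^ t * quad P x \<le> 1 * 1"
      using \<rho> x nonneg[OF x(1)] by (intro mult_mono power_le_one) auto
    then have "quad P (f (trajectory f t x)) \<le> \<rho> * quad P (trajectory f t x)"
      using Suc by (intro step order.trans[OF conjunct2[OF Suc]]) auto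
    also have "\<dots> \<le> \<rho> * (\<rho> ^ t * quad P x)" using Suc \<rho> by (intro mult_left_mono) auto
    finally show ?case using Suc f by simp
  qed (use x in auto)
  have "(vnorm (trajectory f t x))\<^sup>2 \<le> 1 / c * \<rho> ^ t * quad P x"
    if x: "x \<in> carrier_vec n" "quad P x \<le> 1" for x t
  proof -
    have "c * (vnorm (trajectory f t x))\<^sup>2 \<le> quad P (trajectory f t x)"
      unfolding vnorm_power2 using decay[OF x, of t] c(2) by blast
    also have "\<dots> \<le> \<rho> ^ t * quad P x" using decay[OF x] by blast
    finally show ?thesis using c(1) by (simp add: field_simps)
  qed
  then show ?thesis using c(1) \<rho> by (metis zero_less_divide_1_iff)
qed

lemma quadratic_Lyapunov_stable:
  assumes P: "P \<in> carrier_mat n n" "pos_def P"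
    and f: "\<And>x. x \<in> carrier_vec n \<Longrightarrow> f x \<in> carrier_vec n" and fix0: "f (0\<^sub>v n) = 0\<^sub>v n"
    and \<epsilon>: "\<epsilon> > 0"
    and dec: "\<And>x. x \<in> carrier_vec n \<Longrightarrow> quad P x \<le> 1 \<Longrightarrow> quad P (f x) + \<epsilon> * (x \<bullet> x) \<le> quad P x"
  shows "lyapunov_stable n f (0\<^sub>v n)"
    and "\<And>x. x \<in> carrier_vec n \<Longrightarrow> quad P x \<le> 1 \<Longrightarrow>
      (\<lambda>t. vnorm (trajectory f t x - 0\<^sub>v n)) \<longlonglongrightarrow> 0"
proof -
  have traj: "trajectory f t x \<in> carrier_vec n" if "x \<in> carrier_vec n" for t x
    using that f by (induction t) auto
  then have minus0: "trajectory f t x - 0\<^sub>v n = trajectory f t x" if "x \<in> carrier_vec n" for t x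
    using that by (simp add: traj)
  obtain C \<rho> where C: "C > 0" and \<rho>: "0 \<le> \<rho>" "\<rho> < 1" and
    decay: "\<And>x t. x \<in> carrier_vec n \<Longrightarrow> quad P x \<le> 1 \<Longrightarrow> (vnorm (trajectory f t x))\<^sup>2 \<le> C * \<rho> ^ t * quad P x"
  proof -
    have "\<exists>C>0. \<exists>\<rho>. 0 \<le> \<rho> \<and> \<rho> < 1 \<and> (\<forall>x\<in>carrier_vec n. quad P x \<le> 1 \<longrightarrow>
        (\<forall>t. (vnorm (trajectory f t x))\<^sup>2 \<le> C * \<rho> ^ t * quad P x))"
      by (rule quadratic_Lyapunov_decay[OF P f \<epsilon> dec])
    then show ?thesis using that by (elim exE conjE) simp
  qed
  obtain K where K: "K > 0" "\<forall>x\<in>carrier_vec n. quad P x \<le> K * (x \<bullet> x)"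
    using quad_upper_bound[OF P(1)] by blast
  have nonneg: "quad P x \<ge> 0" if "x \<in> carrier_vec n" for x
    using pos_semidef_if_pos_def[OF P(2)] P(1) that unfolding pos_semidef_def by auto
  show "lyapunov_stable n f (0\<^sub>v n)"
    unfolding lyapunov_stable_def
  proof (intro conjI allI impI fix0)
    fix e :: real assume e: "e > 0"
    \<comment> \<open>\<open>V < r\<close> puts the start into the ellipsoid and bounds the trajectory by \<open>e\<close>\<close>
    define r where "r = min 1 (e\<^sup>2 / C)"
    define s where "s = r / K"
    have r: "r > 0" "r \<le> 1" "r \<le> e\<^sup>2 / C" using C e by (auto simp: r_def)
    have s: "s > 0" "K * s = r" using K(1) r(1) by (auto simp: s_def)
    have Cr: "C * r \<le> e\<^sup>2" using r(3) C by (simp add: field_simps)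
    show "\<exists>\<delta>>0. \<forall>x0\<in>carrier_vec n. vnorm (x0 - 0\<^sub>v n) < \<delta> \<longrightarrow>
        (\<forall>t. vnorm (trajectory f t x0 - 0\<^sub>v n) < e)"
    proof (intro exI[of _ "sqrt s"] conjI ballI impI allI)
      fix x t assume x: "x \<in> carrier_vec n" and "vnorm (x - 0\<^sub>v n) < sqrt s"
      then have "x \<bullet> x < s" by (simp add: vnorm_def)
      then have "K * (x \<bullet> x) < K * s" using K(1) by simp
      moreover have "quad P x \<le> K * (x \<bullet> x)" using K(2) x by blast
      ultimately have V: "quad P x < K * s" by linarith
      then have "quad P x \<le> 1" using s(2) r(2) by linarith
      then have "(vnorm (trajectory f t x))\<^sup>2 \<le> C * \<rho> ^ t * quad P x" by (rule decay[OF x])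
      also have "\<dots> \<le> C * 1 * quad P x"
        using C \<rho> nonneg[OF x] by (intro mult_right_mono mult_left_mono power_le_one) auto
      also have "\<dots> < C * (K * s)" using V C by (simp only: mult_1_right mult_less_cancel_left_pos)
      finally have "(vnorm (trajectory f t x))\<^sup>2 < e\<^sup>2" using Cr unfolding s(2) by linarith
      then have "vnorm (trajectory f t x) < e" using e by (simp add: power2_less_imp_less)
      then show "vnorm (trajectory f t x - 0\<^sub>v n) < e" using minus0[OF x] by simp
    qed (use s in auto)
  qed
  show "(\<lambda>t. vnorm (trajectory f t x - 0\<^sub>v n)) \<longlonglongrightarrow> 0"
    if x: "x \<in> carrier_vec n" "quad P x \<le> 1" for x
  proof -
    have "(\<lambda>t. C * \<rho> ^ t * quad P x) \<longlonglongrightarrow> C * 0 * quad P x"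
      using \<rho> by (intro tendsto_intros LIMSEQ_power_zero) auto
    then have bound: "(\<lambda>t. C * \<rho> ^ t * quad P x) \<longlonglongrightarrow> 0" by simp
    have "(\<lambda>t. (vnorm (trajectory f t x))\<^sup>2) \<longlonglongrightarrow> 0"
      using decay[OF x] by (intro tendsto_sandwich[OF always_eventually always_eventually tendsto_const bound]) simp_all
    then have "(\<lambda>t. sqrt ((vnorm (trajectory f t x))\<^sup>2)) \<longlonglongrightarrow> sqrt 0" by (rule tendsto_real_sqrt)
    then show ?thesis using vnorm_nonneg by (simp add: minus0[OF x(1)])
  qed
qed

section \<open>Robust local stability\<close>

theorem theorem2:
  fixes N :: network and S :: plant
    and vlo1 vhi1 vlo vhi \<alpha> \<beta> :: "real vec" and P :: "real mat"
  assumes net: "wf_network N"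
    and plant: "wf_plant S (in_dim N) (out_dim N)"
    and zero: "net_map N (0\<^sub>v (in_dim N)) = 0\<^sub>v (out_dim N)"
    and vhi1: "vhi1 \<in> carrier_vec (width N 1)" "layer_in N (0\<^sub>v (in_dim N)) 1 \<le> vhi1"
    and vlo1: "vlo1 = 2 \<cdot>\<^sub>v layer_in N (0\<^sub>v (in_dim N)) 1 - vhi1"
    and bounds: "vlo \<in> carrier_vec (n_phi N)" "vhi \<in> carrier_vec (n_phi N)"
      "vlo \<le> v_phi N (0\<^sub>v (in_dim N))" "v_phi N (0\<^sub>v (in_dim N)) \<le> vhi"
    and blocks: "vec_first vlo (width N 1) = vlo1" "vec_first vhi (width N 1) = vhi1"
    and propagated: "\<forall>x\<in>carrier_vec (in_dim N).
      vlo1 \<le> weight N 1 *\<^sub>v x + bias N 1 \<and> weight N 1 *\<^sub>v x + bias N 1 \<le> vhi1 \<longrightarrow>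
      vlo \<le> v_phi N x \<and> v_phi N x \<le> vhi"
    and slopes: "\<alpha> \<in> carrier_vec (n_phi N)" "\<beta> \<in> carrier_vec (n_phi N)" "\<alpha> \<le> \<beta>"
    and sector: "\<forall>k<n_phi N. locally_sector_bounded (activation N) (\<alpha> $ k) (\<beta> $ k)
      (v_phi N (0\<^sub>v (in_dim N)) $ k) (vlo $ k) (vhi $ k)"
    and feasible: "LMI_I N S vhi1 \<alpha> \<beta> P \<or> LMI_II N S vhi1 \<alpha> \<beta> P \<or> LMI_III N S vhi1 \<alpha> \<beta> P"
  shows "locally_stable N S (0\<^sub>v (in_dim N)) \<and>
    ellipsoid P (0\<^sub>v (in_dim N)) \<subseteq> robust_roa N S (0\<^sub>v (in_dim N))"
proof -
  let ?n = "in_dim N"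
  obtain lam \<epsilon> where base: "LMI_base N vhi1 P lam" and \<epsilon>: "\<epsilon> > 0"
    and neg: "robustly_negative N S (Z_mat N S \<alpha> \<beta> lam P) P \<epsilon>"
    using feasible_robustly_negative[OF net plant feasible] by blast
  have P: "P \<in> carrier_mat ?n ?n" "pos_def P" and lam: "lam \<in> carrier_vec (n_phi N)" "0\<^sub>v (n_phi N) \<le> lam"
    and N: "cond_N N vhi1 P"
    using base by (auto simp: LMI_base_def)
  have sym: "symmetric_mat P" using P(2) by (simp add: pos_def_def)
  have loop: "lyapunov_stable ?n (closed_loop N A B) (0\<^sub>v ?n) \<and>
      (\<forall>x\<in>carrier_vec ?n. quad P x \<le> 1 \<longrightarrow>
        (\<lambda>t. vnorm (trajectory (closed_loop N A B) t x - 0\<^sub>v ?n)) \<longlonglongrightarrow> 0)"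
    if A: "A \<in> {A_lo S..A_hi S}" and B: "B \<in> {B_lo S..B_hi S}" for A B
  proof -
    have Ac: "A \<in> carrier_mat ?n ?n" and Bc: "B \<in> carrier_mat ?n (out_dim N)"
      using A B plant by (auto simp: wf_plant_def less_eq_mat_def)
    have carrier: "closed_loop N A B x \<in> carrier_vec ?n" if x: "x \<in> carrier_vec ?n" for x
      unfolding closed_loop_def
      by (intro add_carrier_vec mult_mat_vec_carrier[OF Ac x] mult_mat_vec_carrier[OF Bc net_map_carrier[OF net]])
    have equilibrium: "closed_loop N A B (0\<^sub>v ?n) = 0\<^sub>v ?n"
      unfolding closed_loop_def zero mat_mult_zero_vec[OF Ac] mat_mult_zero_vec[OF Bc] by simp
    have decrease: "quad P (closed_loop N A B x) + \<epsilon> * (x \<bullet> x) \<le> quad P x"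
      if x: "x \<in> carrier_vec ?n" "quad P x \<le> 1" for x
    proof -
      let ?w = "w_phi N x - w_phi N (0\<^sub>v ?n)"
      have "vlo \<le> v_phi N x" "v_phi N x \<le> vhi"
        using propagated x(1) first_layer_in_bounds[OF net P(1) vhi1 N x]
        unfolding layer_in_1[of N x] vlo1[symmetric] by blast+
      then have "0 \<le> quad (X_mat N \<alpha> \<beta> lam) (x @\<^sub>v ?w)"
        by (rule quad_X_mat_nonneg_if_sector[OF net slopes(1,2) lam sector x(1)])
      moreover have "?w \<in> carrier_vec (n_phi N)"
        by (intro minus_carrier_vec w_phi_carrier[OF net] x zero_carrier_vec)
      note robust_Lyapunov_decrease[OF net plant P(1) sym \<epsilon> neg A B x(1) this]
      ultimately show ?thesis
        unfolding closed_loop_def net_map_deviation[OF net zero x(1)] by simp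
    qed
    show ?thesis
      using quadratic_Lyapunov_stable[of P ?n "closed_loop N A B" \<epsilon>, OF P carrier equilibrium \<epsilon> decrease]
      by blast
  qed
  have "x \<in> robust_roa N S (0\<^sub>v ?n)" if "x \<in> ellipsoid P (0\<^sub>v ?n)" for x
  proof -
    have x: "x \<in> carrier_vec ?n" using that P(1) by (auto simp: ellipsoid_def)
    then have "quad P x \<le> 1" using that by (simp add: ellipsoid_def)
    then show ?thesis using loop x unfolding robust_roa_def by blast
  qed
  then show ?thesis using loop unfolding locally_stable_def by blast
qed

end
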